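(* Let $f\in\mathcal{M}_S$. Then $f$ has infinitely many weakly repelling fixed points. Moreover, if the bov of $f$ is the only limit point of the set of critical values of $f$, then $f$ has infinitely many repelling fixed points.
   Context: A general transcendental meromorphic function is a meromorphic function $f:\mathbb{C}\to\widehat{\mathbb{C}}$ whose only essential singularity is at $\infty$ and which has either at least two poles or exactly one pole that is not an omitted value. An omitted value is $b\in\mathbb{C}$ with $f(z)\neq b$ for all $z$. A Baker omitted value (bov) is an omitted value $b$ for which there is a disk $D$ centred at $b$ such that each component of the boundary of $f^{-1}(D)$ is bounded; it is stable if all iterates $f^n$ are defined (analytic) in a neighbourhood of $b$. $\mathcal{M}_S$ denotes the class of general transcendental meromorphic functions having a stable bov. A fixed point $z_0$ is weakly repelling if $|f'(z_0)|>1$ or $f'(z_0)=1$, and repelling if $|f'(z_0)|>1$. *)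

theory Defs
  imports "HOL-Complex_Analysis.Complex_Analysis"
begin

definition poles :: "(complex \<Rightarrow> complex) \<Rightarrow> complex set" where
  "poles f = {z. is_pole f z}"

text \<open>A transcendental meromorphic function: meromorphic on the whole plane, analytic
  (with the correct value) at every point that is not a pole, and \<infinity> is an essential
  singularity, i.e. \<infinity> is neither a removable singularity nor a pole (which would require
  in particular that \<infinity> is an isolated singularity, i.e. no poles near \<infinity>).\<close>
definition transcendental_meromorphic :: "(complex \<Rightarrow> complex) \<Rightarrow> bool" where
  "transcendental_meromorphic f \<longleftrightarrow>
     f meromorphic_on UNIV \<and>
     (\<forall>z. z \<notin> poles f \<longrightarrow> f analytic_on {z}) \<and>
     \<not> (\<exists>R. (\<forall>z. norm z > R \<longrightarrow> z \<notin> poles f) \<and>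
            ((\<exists>L. (f \<longlongrightarrow> L) at_infinity) \<or> filterlim f at_infinity at_infinity))"

definition omitted_value :: "(complex \<Rightarrow> complex) \<Rightarrow> complex \<Rightarrow> bool" where
  "omitted_value f b \<longleftrightarrow> (\<forall>z. z \<notin> poles f \<longrightarrow> f z \<noteq> b)"

definition general_transcendental_meromorphic :: "(complex \<Rightarrow> complex) \<Rightarrow> bool" where
  "general_transcendental_meromorphic f \<longleftrightarrow>
     transcendental_meromorphic f \<and>
     ((\<exists>p q. p \<in> poles f \<and> q \<in> poles f \<and> p \<noteq> q) \<or>
      (\<exists>p. poles f = {p} \<and> \<not> omitted_value f p))"

definition baker_omitted_value :: "(complex \<Rightarrow> complex) \<Rightarrow> complex \<Rightarrow> bool" where
  "baker_omitted_value f b \<longleftrightarrow> omitted_value f b \<and>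
     (\<exists>r>0. \<forall>C \<in> components (frontier {z. z \<notin> poles f \<and> f z \<in> ball b r}). bounded C)"

definition stable_bov :: "(complex \<Rightarrow> complex) \<Rightarrow> complex \<Rightarrow> bool" where
  "stable_bov f b \<longleftrightarrow> baker_omitted_value f b \<and>
     (\<forall>n. \<exists>e>0. (\<forall>k<n. \<forall>z\<in>ball b e. (f ^^ k) z \<notin> poles f) \<and>
                 (f ^^ n) holomorphic_on ball b e)"

definition class_MS :: "(complex \<Rightarrow> complex) \<Rightarrow> bool" where
  "class_MS f \<longleftrightarrow> general_transcendental_meromorphic f \<and> (\<exists>b. stable_bov f b)"

definition fixed_points :: "(complex \<Rightarrow> complex) \<Rightarrow> complex set" where
  "fixed_points f = {z. z \<notin> poles f \<and> f z = z}"

definition weakly_repelling_fp :: "(complex \<Rightarrow> complex) \<Rightarrow> complex \<Rightarrow> bool" where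
  "weakly_repelling_fp f z \<longleftrightarrow> z \<in> fixed_points f \<and> (norm (deriv f z) > 1 \<or> deriv f z = 1)"

definition repelling_fp :: "(complex \<Rightarrow> complex) \<Rightarrow> complex \<Rightarrow> bool" where
  "repelling_fp f z \<longleftrightarrow> z \<in> fixed_points f \<and> norm (deriv f z) > 1"

text \<open>Finite critical values (critical values at multiple poles are \<infinity>).\<close>
definition critical_values :: "(complex \<Rightarrow> complex) \<Rightarrow> complex set" where
  "critical_values f = f ` {c. c \<notin> poles f \<and> deriv f c = 0}"

end

theory Submission
  imports Defs
begin

text \<open>
  Let \<open>b\<close> be the bov and \<open>h = 1 / (f - b)\<close>, an entire function. The preimage of a disk around
  \<open>b\<close> is a superlevel set \<open>{|h| > M}\<close>, so boundedness of the components of its boundary makes every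
  component \<open>\<Omega>\<close> of \<open>{|h| < M}\<close> bounded and simply connected, with \<open>h : \<Omega> \<rightarrow> {|h| < M}\<close> proper; since
  \<open>\<infinity>\<close> is an essential singularity, there are such components arbitrarily far out.
  With \<open>w(z) = 1 / (z - b)\<close>, the fixed points of \<open>f\<close> in \<open>\<Omega>\<close> are the zeros of \<open>w - h\<close>, with
  multiplier \<open>\<lambda> = h' / w'\<close>, and \<open>w\<close> is tiny on a far component.

  If no fixed point in \<open>\<Omega>\<close> were weakly repelling, then \<open>Re (1 / (1 - \<lambda>)) \<ge> 1 / 2\<close> at each of the
  \<open>d \<ge> 1\<close> fixed points. But \<open>\<Sum> 1 / (1 - \<lambda>)\<close> is the derivative at \<open>t = 0\<close> of the sum \<open>S(t)\<close> of \<open>w\<close> over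
  the \<open>d\<close> solutions of \<open>w - h = t\<close>, which is holomorphic and bounded by \<open>d sup |w|\<close>; the Cauchy
  estimate makes it smaller than \<open>d / 2\<close>.

  If the critical values of \<open>f\<close> are bounded, then for far \<open>\<Omega>\<close> the map \<open>h\<close> is a covering over \<open>w(\<Omega>)\<close>,
  and lifting \<open>w\<close> through \<open>h\<close> at a fixed point \<open>p\<close> gives a local inverse \<open>g : \<Omega> \<rightarrow> \<Omega>\<close> of \<open>f\<close> with relatively
  compact image. By the Schwarz lemma \<open>|g'(p)| < 1\<close>, so \<open>p\<close> is repelling.
\<close>

subsection \<open>Sums over the zeros of a proper holomorphic function\<close>

text \<open>Differentiation under the integral sign: \<open>T\<close> keeps \<open>k x - s\<close>
  away from 0 on the circle for every \<open>s\<close> in \<open>ball 0 T\<close>, so the Leibniz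
  rule applies to the parametrised integral. It serves to differentiate a sum over the solutions of
  \<open>k x = t\<close> with respect to \<open>t\<close>.\<close>

lemma has_field_derivative_circlepath_transform:
  fixes k \<phi> :: "complex \<Rightarrow> complex"
  assumes "continuous_on (sphere 0 \<rho>) k" "continuous_on (sphere 0 \<rho>) \<phi>"
    and "0 < \<rho>" and "\<And>x. norm x = \<rho> \<Longrightarrow> T \<le> norm (k x)" and "norm t < T"
  shows "((\<lambda>t. contour_integral (circlepath 0 \<rho>) (\<lambda>x. \<phi> x / (k x - t))) has_field_derivative
           contour_integral (circlepath 0 \<rho>) (\<lambda>x. \<phi> x / (k x - t)\<^sup>2)) (at t)"
proof -
  define \<gamma> where "\<gamma> = circlepath 0 \<rho>"
  define \<gamma>' where "\<gamma>' = (\<lambda>x. 2 * pi * \<i> * \<rho> * exp (2 * of_real pi * \<i> * of_real x))"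
  have vd: "vector_derivative \<gamma> (at x) = \<gamma>' x" for x
    by (simp add: \<gamma>_def \<gamma>'_def vector_derivative_circlepath)
  have g_eq: "\<gamma> x = \<rho> * exp (2 * of_real pi * \<i> * of_real x)" for x
    by (simp add: \<gamma>_def circlepath)
  have sph: "norm (\<gamma> x) = \<rho>" for x
    using \<open>0 < \<rho>\<close> by (simp add: g_eq norm_mult)
  have nz: "k (\<gamma> x) - s \<noteq> 0" if "s \<in> ball 0 T" for s x
    using assms(4)[OF sph[of x]] that by auto
  have c\<gamma>: "continuous_on A \<gamma>" "continuous_on A \<gamma>'" for A
    unfolding \<gamma>'_def by (auto simp: g_eq[abs_def] intro!: continuous_intros)
  have ck: "continuous_on A (\<lambda>x. k (\<gamma> x))" and c\<phi>: "continuous_on A (\<lambda>x. \<phi> (\<gamma> x))" for A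
    by (rule continuous_on_compose2[OF assms(1) c\<gamma>(1)], use sph in auto)
       (rule continuous_on_compose2[OF assms(2) c\<gamma>(1)], use sph in auto)
  have "((\<lambda>s. integral (cbox 0 1) (\<lambda>x. \<phi> (\<gamma> x) / (k (\<gamma> x) - s) * \<gamma>' x)) has_field_derivative
          integral (cbox 0 1) (\<lambda>x. \<phi> (\<gamma> x) / (k (\<gamma> x) - t)\<^sup>2 * \<gamma>' x)) (at t within ball 0 T)"
  proof (rule leibniz_rule_field_derivative)
    show "((\<lambda>s. \<phi> (\<gamma> x) / (k (\<gamma> x) - s) * \<gamma>' x) has_field_derivative
             \<phi> (\<gamma> x) / (k (\<gamma> x) - s)\<^sup>2 * \<gamma>' x) (at s within ball 0 T)"
      if "s \<in> ball 0 T" for s x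
      using nz[OF that] by (auto intro!: derivative_eq_intros simp: power2_eq_square)
    show "(\<lambda>x. \<phi> (\<gamma> x) / (k (\<gamma> x) - s) * \<gamma>' x) integrable_on cbox 0 1"
      if "s \<in> ball 0 T" for s
      by (intro integrable_continuous continuous_intros ck c\<phi> c\<gamma>) (use nz[OF that] in auto)
    have ck': "continuous_on (ball 0 T \<times> cbox 0 1) (\<lambda>x. k (\<gamma> (snd x)))"
      by (rule continuous_on_compose2[OF ck continuous_on_snd[OF continuous_on_id]]) auto
    have cp': "continuous_on (ball 0 T \<times> cbox 0 1) (\<lambda>x. \<phi> (\<gamma> (snd x)))"
      by (rule continuous_on_compose2[OF c\<phi> continuous_on_snd[OF continuous_on_id]]) auto
    have cg': "continuous_on (ball 0 T \<times> cbox 0 1) (\<lambda>x. \<gamma>' (snd x))"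
      by (rule continuous_on_compose2[OF c\<gamma>(2) continuous_on_snd[OF continuous_on_id]]) auto
    show "continuous_on (ball 0 T \<times> cbox 0 1) (\<lambda>(s, x). \<phi> (\<gamma> x) / (k (\<gamma> x) - s)\<^sup>2 * \<gamma>' x)"
      unfolding split_beta by (intro continuous_intros ck' cp' cg') (use nz in auto)
  qed (use assms in auto)
  then have "((\<lambda>s. integral (cbox 0 1) (\<lambda>x. \<phi> (\<gamma> x) / (k (\<gamma> x) - s) * \<gamma>' x)) has_field_derivative
          integral (cbox 0 1) (\<lambda>x. \<phi> (\<gamma> x) / (k (\<gamma> x) - t)\<^sup>2 * \<gamma>' x)) (at t)"
    using \<open>norm t < T\<close> by (subst (asm) at_within_open) auto
  then show ?thesis
    by (simp add: contour_integral_integral vd flip: \<gamma>_def)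
qed

text \<open>The sum over \<open>Z\<close> is the derivative at 0 of the sum of \<open>a\<close> over
  the solutions of \<open>k = t\<close>. The latter has \<open>card Z\<close> terms counted with
  multiplicity, so it is at most \<open>\<epsilon> * card Z\<close>, and the Cauchy estimate on
  radius \<open>\<tau>\<close> divides this by \<open>\<tau>\<close>. The lower bound on
  \<open>k\<close> near the unit circle keeps all solutions inside radius
  \<open>\<rho>\<close>.\<close>

lemma norm_sum_deriv_quotient_zeros_le:
  fixes k a :: "complex \<Rightarrow> complex"
  assumes k: "k holomorphic_on ball 0 1" and a: "a holomorphic_on ball 0 1"
    and \<rho>: "0 < \<rho>" "\<rho> < 1" and kT: "\<And>x. \<lbrakk>\<rho> \<le> norm x; norm x < 1\<rbrakk> \<Longrightarrow> T \<le> norm (k x)"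
    and ae: "\<And>x. norm x < 1 \<Longrightarrow> norm (a x) \<le> \<epsilon>"
    and simple: "\<And>x. \<lbrakk>norm x < 1; k x = 0\<rbrakk> \<Longrightarrow> deriv k x \<noteq> 0"
    and \<tau>: "0 < \<tau>" "\<tau> < T"
  defines "Z \<equiv> {x \<in> ball 0 1. k x = 0}"
  shows "finite Z" and "norm (\<Sum>x\<in>Z. deriv a x / deriv k x) \<le> \<epsilon> * card Z / \<tau>"
proof -
  define \<gamma> where "\<gamma> = circlepath 0 \<rho>"
  define Zt where "Zt = (\<lambda>t. {x \<in> ball 0 1. k x - t = 0})"
  have [simp]: "valid_path \<gamma>" "pathfinish \<gamma> = pathstart \<gamma>"
    by (simp_all add: \<gamma>_def)
  have im: "path_image \<gamma> = sphere 0 \<rho>" using \<rho> by (simp add: \<gamma>_def)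
  have sub: "sphere 0 \<rho> \<subseteq> ball (0::complex) 1" using \<rho> by auto
  have wn0: "\<forall>z. z \<notin> ball 0 1 \<longrightarrow> winding_number \<gamma> z = 0"
    by (intro allI impI simply_connected_imp_winding_number_zero[of "ball 0 1"])
       (use \<rho> im in \<open>auto simp: valid_path_imp_path convex_imp_simply_connected\<close>)
  have wn1: "winding_number \<gamma> z = 1" if "norm z < \<rho>" for z
    using that by (simp add: \<gamma>_def winding_number_circlepath)
  have Zt_in: "norm x < \<rho>" if "norm t < T" "x \<in> Zt t" for t x
    using kT[of x] that by (force simp: Zt_def)
  have hk: "(\<lambda>x. k x - t) holomorphic_on ball 0 1" for t
    by (intro holomorphic_intros k)
  have fin: "finite (Zt t)" if t: "norm t < T" for t
  proof -
    \<comment> \<open>At the real point \<open>\<rho>\<close> the modulus of \<open>k\<close> is at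
      least \<open>T\<close>, hence larger than \<open>norm t\<close>, so \<open>k - t\<close> is
      nonzero there while it vanishes at \<open>x0\<close>.\<close>
    have nc: "\<not> (\<lambda>x. k x - t) constant_on ball 0 1" if "x0 \<in> Zt t" for x0
    proof
      assume "(\<lambda>x. k x - t) constant_on ball 0 1"
      moreover have "of_real \<rho> \<in> ball (0::complex) 1" using \<rho> by simp
      ultimately have "k (of_real \<rho>) - t = k x0 - t"
        using that unfolding constant_on_def Zt_def by (metis (mono_tags, lifting) mem_Collect_eq)
      then show False
        using kT[of "of_real \<rho>"] \<rho> that t by (auto simp: Zt_def)
    qed
    have "finite {x \<in> cball 0 \<rho>. k x - t = 0}" if "x0 \<in> Zt t" for x0
      by (rule holomorphic_compact_finite_zeros[OF hk]) (use \<rho> nc[OF that] in auto)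
    moreover have "Zt t \<subseteq> {x \<in> cball 0 \<rho>. k x - t = 0}"
      using Zt_in[OF t] by (force simp: Zt_def)
    ultimately show ?thesis
      by (metis finite.emptyI finite_subset equals0I)
  qed
  have notZ: "k x \<noteq> t" if "norm t < T" "norm x = \<rho>" for x t
    using kT[of x] \<rho> that by auto
  have Zt0: "Zt 0 = Z" by (simp add: Zt_def Z_def)
  have T: "0 < T" using \<tau> by simp
  show "finite Z" using fin[of 0] T Zt0 by simp
  have zpos: "zorder (\<lambda>x. k x - t) p > 0" if t: "norm t < T" and p: "p \<in> Zt t" for t p
  proof -
    have "\<exists>w\<in>ball 0 1. k w - t \<noteq> 0"
    proof (rule bexI[of _ "of_real \<rho>"])
      show "k (of_real \<rho>) - t \<noteq> 0" using kT[of "of_real \<rho>"] \<rho> t by auto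
    qed (use \<rho> in auto)
    then obtain r where "(if k p - t = 0 then zorder (\<lambda>x. k x - t) p > 0 else zorder (\<lambda>x. k x - t) p = 0)"
      using zorder_exist_zero[OF hk[of t] open_ball connected_ball, of p] p
      by (metis (mono_tags, lifting) Zt_def mem_Collect_eq)
    then show ?thesis using p by (simp add: Zt_def)
  qed
  \<comment> \<open>The argument principle with weight \<open>u\<close>; all zeros lie inside the
    circle, so the winding numbers are 1.\<close>
  have arg: "contour_integral \<gamma> (\<lambda>x. deriv k x * u x / (k x - t)) =
      2 * pi * \<i> * (\<Sum>p\<in>Zt t. u p * of_int (zorder (\<lambda>x. k x - t) p))"
    if t: "norm t < T" and u: "u holomorphic_on ball 0 1" for t u
  proof -
    have "contour_integral \<gamma> (\<lambda>x. deriv (\<lambda>x. k x - t) x * u x / (k x - t)) =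
      2 * pi * \<i> * (\<Sum>p\<in>{w \<in> ball 0 1. k w - t = 0 \<or> w \<in> {}}. winding_number \<gamma> p * u p *
         of_int (zorder (\<lambda>x. k x - t) p))"
    proof (rule argument_principle)
      show "path_image \<gamma> \<subseteq> ball 0 1 - {w \<in> ball 0 1. k w - t = 0 \<or> w \<in> {}}"
        using im \<rho> notZ[OF t] by fastforce
      show "finite {w \<in> ball 0 1. k w - t = 0 \<or> w \<in> {}}"
        using fin[OF t] by (simp add: Zt_def)
    qed (use u hk wn0 in auto)
    also have "{w \<in> ball 0 1. k w - t = 0 \<or> w \<in> {}} = Zt t" by (simp add: Zt_def)
    also have "contour_integral \<gamma> (\<lambda>x. deriv (\<lambda>x. k x - t) x * u x / (k x - t)) =
               contour_integral \<gamma> (\<lambda>x. deriv k x * u x / (k x - t))"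
    proof (rule contour_integral_cong)
      fix x assume "x \<in> path_image \<gamma>"
      then have "x \<in> ball 0 1" using im \<rho> by auto
      then have "k field_differentiable at x"
        using k by (simp add: holomorphic_on_imp_differentiable_at)
      then show "deriv (\<lambda>x. k x - t) x * u x / (k x - t) = deriv k x * u x / (k x - t)"
        by simp
    qed auto
    finally show ?thesis
      using Zt_in[OF t] wn1 by (simp cong: sum.cong)
  qed
  have z1: "zorder k p = 1" if "p \<in> Z" for p
  proof -
    have "zorder k p = 1"
      by (rule zorder_zero_eqI[of k "ball 0 1"]) (use that k simple in \<open>auto simp: Z_def\<close>)
    then show ?thesis .
  qed
  \<comment> \<open>Rouche's theorem compares \<open>k\<close> with \<open>k - t\<close> on the
    circle; at \<open>t = 0\<close> the zeros are simple, so the count with multiplicity is the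
    cardinality.\<close>
  have d: "(\<Sum>p\<in>Zt t. zorder (\<lambda>x. k x - t) p) = int (card Z)" if t: "norm t < T" for t
  proof -
    have eq1: "{p \<in> ball 0 1. k p + - t = 0} = Zt t" by (simp add: Zt_def)
    have eq2: "{p \<in> ball 0 1. k p = 0} = Zt 0" by (simp add: Zt_def)
    have "(\<Sum>p\<in>{p \<in> ball 0 1. k p + - t = 0}. winding_number \<gamma> p * of_int (zorder (\<lambda>p. k p + - t) p))
          = (\<Sum>p\<in>{p \<in> ball 0 1. k p = 0}. winding_number \<gamma> p * of_int (zorder k p))"
    proof (rule Rouche_theorem)
      show "\<forall>z\<in>path_image \<gamma>. norm (- t) < norm (k z)"
      proof
        fix z assume "z \<in> path_image \<gamma>"
        then show "norm (- t) < norm (k z)" using kT[of z] im \<rho> t by simp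
      qed
      show "finite {p \<in> ball 0 1. k p + - t = 0}" "finite {p \<in> ball 0 1. k p = 0}"
        unfolding eq1 eq2 using fin[OF t] fin[of 0] T by auto
      show "path_image \<gamma> \<subseteq> ball 0 1" using im sub by simp
    qed (use k wn0 in auto)
    then have "(\<Sum>p\<in>Zt t. winding_number \<gamma> p * of_int (zorder (\<lambda>p. k p - t) p))
          = (\<Sum>p\<in>Zt 0. winding_number \<gamma> p * of_int (zorder k p))"
      by (simp add: eq2 Zt_def)
    moreover have "(\<Sum>p\<in>Zt t. winding_number \<gamma> p * of_int (zorder (\<lambda>p. k p - t) p))
          = of_int (\<Sum>p\<in>Zt t. zorder (\<lambda>p. k p - t) p)"
      using Zt_in[OF t] wn1 by (simp cong: sum.cong)
    moreover have "(\<Sum>p\<in>Zt 0. winding_number \<gamma> p * of_int (zorder k p)) = of_int (int (card Z))"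
      using Zt_in[of 0] T wn1 z1 by (simp add: Zt0 cong: sum.cong)
    ultimately show ?thesis by (metis of_int_eq_iff)
  qed
  \<comment> \<open>Up to the factor \<open>2 \<pi> \<i>\<close>, \<open>S t\<close> is the sum of \<open>a\<close> over the solutions of \<open>k = t\<close>; by Rouche's theorem
    their number does not depend on \<open>t\<close>.\<close>
  define S where "S = (\<lambda>t. contour_integral \<gamma> (\<lambda>x. deriv k x * a x / (k x - t)))"
  have Sb: "norm (S t) \<le> 2 * pi * (\<epsilon> * card Z)" if t: "norm t < T" for t
  proof -
    have "norm (\<Sum>p\<in>Zt t. a p * of_int (zorder (\<lambda>x. k x - t) p)) \<le>
          (\<Sum>p\<in>Zt t. \<epsilon> * of_int (zorder (\<lambda>x. k x - t) p))"
    proof (rule sum_norm_le)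
      fix p assume p: "p \<in> Zt t"
      then have "norm (a p) \<le> \<epsilon>" using ae by (simp add: Zt_def)
      then show "norm (a p * of_int (zorder (\<lambda>x. k x - t) p)) \<le> \<epsilon> * of_int (zorder (\<lambda>x. k x - t) p)"
        using zpos[OF t p] by (simp add: norm_mult mult_right_mono)
    qed
    also have "\<dots> = \<epsilon> * of_int (\<Sum>p\<in>Zt t. zorder (\<lambda>x. k x - t) p)"
      by (simp only: sum_distrib_left of_int_sum)
    also have "\<dots> = \<epsilon> * card Z" using d[OF t] by simp
    finally show ?thesis
      using arg[OF t a] by (simp add: S_def norm_mult)
  qed
  have dk: "deriv k holomorphic_on ball 0 1" by (intro holomorphic_deriv k) auto
  have cont: "continuous_on (sphere 0 \<rho>) k" "continuous_on (sphere 0 \<rho>) a"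
      "continuous_on (sphere 0 \<rho>) (deriv k)" "continuous_on (sphere 0 \<rho>) (deriv a)"
    using k a dk holomorphic_deriv[OF a open_ball]
    by (blast intro: continuous_on_subset[OF _ sub] holomorphic_on_imp_continuous_on)+
  have S': "(S has_field_derivative contour_integral \<gamma> (\<lambda>x. deriv k x * a x / (k x - t)\<^sup>2)) (at t)"
    if t: "norm t < T" for t
    unfolding S_def \<gamma>_def
    by (rule has_field_derivative_circlepath_transform[where T=T])
       (use t \<rho> kT in \<open>auto intro: continuous_intros cont\<close>)
  have hS: "S holomorphic_on ball 0 T"
    unfolding holomorphic_on_open[OF open_ball] using S' by fastforce
  have "norm ((deriv ^^ 1) S 0) \<le> fact 1 * (2 * pi * (\<epsilon> * card Z)) / \<tau> ^ 1"
  proof (rule Cauchy_inequality)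
    show "S holomorphic_on ball 0 \<tau>"
      using hS \<tau> by (elim holomorphic_on_subset) auto
    have "S holomorphic_on cball 0 \<tau>"
      using hS \<tau> by (elim holomorphic_on_subset) auto
    then show "continuous_on (cball 0 \<tau>) S"
      by (rule holomorphic_on_imp_continuous_on)
  qed (use \<tau> Sb in auto)
  then have dS: "norm (deriv S 0) \<le> 2 * pi * (\<epsilon> * card Z) / \<tau>"
    by simp
  have nz: "k x \<noteq> 0" if "x \<in> sphere 0 \<rho>" for x
    using notZ[of 0] T that by simp
  \<comment> \<open>The zeros of \<open>k\<close> are simple, so the residue of
    \<open>a' / k\<close> at a zero \<open>p\<close> is \<open>a' p / k' p\<close>.\<close>
  have res: "contour_integral \<gamma> (\<lambda>x. deriv a x / k x) = 2 * pi * \<i> * (\<Sum>p\<in>Z. deriv a p / deriv k p)"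
  proof -
    have "contour_integral \<gamma> (\<lambda>x. deriv a x / k x) =
       2 * pi * \<i> * (\<Sum>p\<in>Z. winding_number \<gamma> p * residue (\<lambda>x. deriv a x / k x) p)"
    proof (rule Residue_theorem[of "ball 0 1"])
      show "(\<lambda>x. deriv a x / k x) holomorphic_on ball 0 1 - Z"
        by (intro holomorphic_intros holomorphic_on_subset[OF k]
              holomorphic_on_subset[OF holomorphic_deriv[OF a open_ball]]) (auto simp: Z_def)
      show "path_image \<gamma> \<subseteq> ball 0 1 - Z"
        unfolding im using nz sub by (auto simp: Z_def)
    qed (use \<open>finite Z\<close> wn0 in auto)
    also have "(\<Sum>p\<in>Z. winding_number \<gamma> p * residue (\<lambda>x. deriv a x / k x) p) =
               (\<Sum>p\<in>Z. deriv a p / deriv k p)"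
    proof (rule sum.cong)
      fix p assume p: "p \<in> Z"
      then have pb: "p \<in> ball 0 1" "k p = 0" by (auto simp: Z_def)
      have "p \<in> Zt 0" using p Zt0 by simp
      then have "winding_number \<gamma> p = 1" using Zt_in[of 0 p] T wn1 by simp
      moreover have "residue (\<lambda>x. deriv a x / k x) p = deriv a p / deriv k p"
      proof (rule residue_simple')
        show "open (ball 0 1 - (Z - {p}))" "p \<in> ball 0 1 - (Z - {p})"
          using \<open>finite Z\<close> pb by (auto intro!: open_Diff finite_imp_closed)
        show "(\<lambda>x. deriv a x / k x) holomorphic_on ball 0 1 - (Z - {p}) - {p}"
          by (intro holomorphic_intros holomorphic_on_subset[OF k]
                holomorphic_on_subset[OF holomorphic_deriv[OF a open_ball]])
             (auto simp: Z_def)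
        have "((\<lambda>w. (k w - k p) / (w - p)) \<longlongrightarrow> deriv k p) (at p)"
          using holomorphic_derivI[OF k open_ball pb(1)] by (simp add: has_field_derivative_iff)
        moreover have "(deriv a \<longlongrightarrow> deriv a p) (at p)"
          using holomorphic_on_imp_continuous_on[OF holomorphic_deriv[OF a open_ball]] pb(1)
          by (simp add: continuous_on_eq_continuous_at isCont_def)
        ultimately have "((\<lambda>w. deriv a w / ((k w - k p) / (w - p))) \<longlongrightarrow> deriv a p / deriv k p) (at p)"
          using simple pb by (intro tendsto_divide) auto
        then show "((\<lambda>w. deriv a w / k w * (w - p)) \<longlongrightarrow> deriv a p / deriv k p) (at p)"
          using pb(2) by simp
      qed
      ultimately show "winding_number \<gamma> p * residue (\<lambda>x. deriv a x / k x) p = deriv a p / deriv k p"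
        by simp
    qed auto
    finally show ?thesis .
  qed
  \<comment> \<open>Integration by parts: the integrand is the derivative of \<open>a / k\<close>,
    so its integral over the closed circle vanishes. This turns \<open>deriv S 0\<close> into the
    integral of \<open>a' / k\<close>.\<close>
  have "((\<lambda>x. deriv a x / k x - deriv k x * a x / (k x)\<^sup>2) has_contour_integral 0) \<gamma>"
  proof (rule Cauchy_theorem_primitive[where S = "sphere 0 \<rho>"])
    show "((\<lambda>x. a x / k x) has_field_derivative deriv a x / k x - deriv k x * a x / (k x)\<^sup>2)
            (at x within sphere 0 \<rho>)" if x: "x \<in> sphere 0 \<rho>" for x
    proof -
      have "(a has_field_derivative deriv a x) (at x within sphere 0 \<rho>)"
        "(k has_field_derivative deriv k x) (at x within sphere 0 \<rho>)"
        using x sub by (auto intro!: holomorphic_derivI[OF a] holomorphic_derivI[OF k])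
      then show ?thesis
        using nz[OF x] by (auto intro!: derivative_eq_intros simp: field_simps power2_eq_square)
    qed
  qed (use im in auto)
  then have int0: "contour_integral \<gamma> (\<lambda>x. deriv a x / k x - deriv k x * a x / (k x)\<^sup>2) = 0"
    by (rule contour_integral_unique)
  have "contour_integral \<gamma> (\<lambda>x. deriv k x * a x / (k x)\<^sup>2) = contour_integral \<gamma> (\<lambda>x. deriv a x / k x)"
  proof -
    have "(\<lambda>x. deriv a x / k x) contour_integrable_on \<gamma>"
      "(\<lambda>x. deriv k x * a x / (k x)\<^sup>2) contour_integrable_on \<gamma>"
      unfolding \<gamma>_def using nz \<rho>
      by (auto intro!: contour_integrable_continuous_circlepath continuous_intros cont)
    from contour_integral_diff[OF this] int0 show ?thesis by simp
  qed
  with S'[of 0] T have "deriv S 0 = contour_integral \<gamma> (\<lambda>x. deriv a x / k x)"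
    by (simp add: DERIV_imp_deriv)
  with res dS have "2 * pi * norm (\<Sum>p\<in>Z. deriv a p / deriv k p) \<le> 2 * pi * (\<epsilon> * card Z / \<tau>)"
    by (simp add: norm_mult)
  then show "norm (\<Sum>x\<in>Z. deriv a x / deriv k x) \<le> \<epsilon> * card Z / \<tau>"
    by (rule mult_left_le_imp_le) simp
qed

section \<open>Riemann maps, and transport of the estimate to simply connected domains\<close>

lemma normalized_Riemann_map:
  fixes \<Omega> :: "complex set"
  assumes "open \<Omega>" "simply_connected \<Omega>" "bounded \<Omega>" "p \<in> \<Omega>"
  obtains \<phi> \<psi> where "\<phi> holomorphic_on \<Omega>" "\<psi> holomorphic_on ball 0 1"
    "\<And>z. z \<in> \<Omega> \<Longrightarrow> \<phi> z \<in> ball 0 1" "\<And>z. z \<in> \<Omega> \<Longrightarrow> \<psi> (\<phi> z) = z"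
    "\<And>x. x \<in> ball 0 1 \<Longrightarrow> \<psi> x \<in> \<Omega>" "\<And>x. x \<in> ball 0 1 \<Longrightarrow> \<phi> (\<psi> x) = x"
    "\<phi> p = 0"
proof -
  have "\<Omega> \<noteq> {}" "\<Omega> \<noteq> UNIV" using assms by auto
  then obtain f g where f: "f holomorphic_on \<Omega>" and g: "g holomorphic_on ball 0 1"
    and fg: "\<And>z. z \<in> \<Omega> \<Longrightarrow> f z \<in> ball 0 1 \<and> g (f z) = z"
    and gf: "\<And>z. z \<in> ball 0 1 \<Longrightarrow> g z \<in> \<Omega> \<and> f (g z) = z"
    using Riemann_mapping_theorem[of \<Omega>] assms by metis
  \<comment> \<open>A disk automorphism moves \<open>f p\<close> to 0; its inverse has parameter
    \<open>- f p\<close>.\<close>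
  define m where "m = Moebius_function 0"
  have fp: "norm (f p) < 1" using fg[OF \<open>p \<in> \<Omega>\<close>] by simp
  have m_in: "m w x \<in> ball 0 1" if "norm w < 1" "x \<in> ball 0 1" for w x
    using that by (simp add: m_def Moebius_function_norm_lt_1)
  have m_inv: "m (f p) (m (- f p) x) = x" "m (- f p) (m (f p) x) = x" if "x \<in> ball 0 1" for x
    unfolding m_def by (rule Moebius_function_compose; use fp that in simp)+
  have m_holo: "m w holomorphic_on ball 0 1" if "norm w < 1" for w
    using that by (simp add: m_def Moebius_function_holomorphic)
  show ?thesis
  proof (rule that[of "m (f p) \<circ> f" "g \<circ> m (- f p)"])
    show "m (f p) \<circ> f holomorphic_on \<Omega>"
      by (rule holomorphic_on_compose_gen[OF f m_holo]) (use fp fg in auto)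
    show "g \<circ> m (- f p) holomorphic_on ball 0 1"
      by (rule holomorphic_on_compose_gen[OF m_holo g]) (use fp m_in[of "- f p"] in auto)
    show "(m (f p) \<circ> f) p = 0"
      by (simp add: m_def Moebius_function_eq_zero)
  qed (use fp fg gf m_in[of "f p"] m_in[of "- f p"] m_inv in \<open>simp_all del: mem_ball\<close>)
qed

lemma compact_subset_ball_imp_smaller_ball:
  fixes K :: "'a::real_normed_vector set"
  assumes "compact K" "K \<subseteq> ball 0 r" "0 < r"
  obtains \<rho> where "0 < \<rho>" "\<rho> < r" "K \<subseteq> ball 0 \<rho>"
proof (cases "K = {}")
  case True
  then show ?thesis using that[of "r / 2"] \<open>0 < r\<close> by simp
next
  case False
  then obtain x where x: "x \<in> K" "\<And>y. y \<in> K \<Longrightarrow> norm y \<le> norm x"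
    using continuous_attains_sup[OF \<open>compact K\<close>, of norm] continuous_on_norm_id by blast
  have *: "norm x < r" using x(1) assms(2) by auto
  define \<rho> where "\<rho> = (norm x + r) / 2"
  have \<rho>: "norm x < \<rho>" "\<rho> < r" using * by (auto simp: \<rho>_def)
  then have "K \<subseteq> ball 0 \<rho>" using x(2) by force
  moreover have "0 < \<rho>" using \<rho>(1) norm_ge_zero[of x] by linarith
  ultimately show ?thesis using \<rho>(2) that by blast
qed

lemma deriv_mult_eq_1_if_left_inverse:
  fixes \<phi> \<psi> :: "complex \<Rightarrow> complex"
  assumes "\<phi> holomorphic_on A" "open A" "\<psi> holomorphic_on B" "open B" "x \<in> B"
    and "\<And>x. x \<in> B \<Longrightarrow> \<psi> x \<in> A" "\<And>x. x \<in> B \<Longrightarrow> \<phi> (\<psi> x) = x"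
  shows "deriv \<phi> (\<psi> x) * deriv \<psi> x = 1"
proof -
  have "((\<phi> \<circ> \<psi>) has_field_derivative deriv \<phi> (\<psi> x) * deriv \<psi> x) (at x)"
    using assms by (intro DERIV_chain) (auto intro!: holomorphic_derivI)
  then have "((\<lambda>x. x) has_field_derivative deriv \<phi> (\<psi> x) * deriv \<psi> x) (at x)"
    by (rule has_field_derivative_transform_within_open[OF _ \<open>open B\<close> \<open>x \<in> B\<close>]) (use assms in simp)
  then show ?thesis
    using DERIV_unique[OF _ DERIV_ident] by blast
qed

text \<open>A quotient of two derivatives is invariant under a conformal change of variable, because
  the factor \<open>deriv \<psi>\<close> cancels; so the disk estimate applies to
  \<open>k \<circ> \<psi>\<close> and \<open>a \<circ> \<psi>\<close>. Compactness of the sublevel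
  set supplies the annulus on which \<open>k \<circ> \<psi>\<close> is large.\<close>

lemma norm_sum_deriv_quotient_zeros_le_simply_connected:
  fixes k a :: "complex \<Rightarrow> complex"
  assumes \<Omega>: "open \<Omega>" "simply_connected \<Omega>" "bounded \<Omega>" "\<Omega> \<noteq> {}"
    and k: "k holomorphic_on \<Omega>" and a: "a holomorphic_on \<Omega>"
    and proper: "compact {z \<in> \<Omega>. norm (k z) \<le> \<sigma>}"
    and ae: "\<And>z. z \<in> \<Omega> \<Longrightarrow> norm (a z) \<le> \<epsilon>"
    and simple: "\<And>z. \<lbrakk>z \<in> \<Omega>; k z = 0\<rbrakk> \<Longrightarrow> deriv k z \<noteq> 0"
    and \<tau>: "0 < \<tau>" "\<tau> < \<sigma>"
  defines "Z \<equiv> {z \<in> \<Omega>. k z = 0}"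
  shows "finite Z" and "norm (\<Sum>z\<in>Z. deriv a z / deriv k z) \<le> \<epsilon> * card Z / \<tau>"
proof -
  obtain p where "p \<in> \<Omega>" using \<Omega> by blast
  from normalized_Riemann_map[OF \<Omega>(1-3) this] obtain \<phi> \<psi> where
    \<phi>: "\<phi> holomorphic_on \<Omega>" "\<And>z. z \<in> \<Omega> \<Longrightarrow> \<phi> z \<in> ball 0 1" "\<And>z. z \<in> \<Omega> \<Longrightarrow> \<psi> (\<phi> z) = z" and
    \<psi>: "\<psi> holomorphic_on ball 0 1" "\<And>x. x \<in> ball 0 1 \<Longrightarrow> \<psi> x \<in> \<Omega>" "\<And>x. x \<in> ball 0 1 \<Longrightarrow> \<phi> (\<psi> x) = x"
    by metis
  have dn: "deriv \<psi> x \<noteq> 0" if "x \<in> ball 0 1" for x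
    using deriv_mult_eq_1_if_left_inverse[OF \<phi>(1) \<Omega>(1) \<psi>(1) open_ball that \<psi>(2,3)] by auto
  have dcomp: "deriv (u \<circ> \<psi>) x = deriv u (\<psi> x) * deriv \<psi> x"
    if "x \<in> ball 0 1" "u holomorphic_on \<Omega>" for x u
    using that \<psi> \<Omega>(1) by (intro deriv_chain) (auto intro: holomorphic_on_imp_differentiable_at)
  define K where "K = {z \<in> \<Omega>. norm (k z) \<le> \<sigma>}"
  have "compact (\<phi> ` K)"
    using proper \<phi>(1) unfolding K_def
    by (intro compact_continuous_image holomorphic_on_imp_continuous_on)
       (auto elim: holomorphic_on_subset)
  moreover have "\<phi> ` K \<subseteq> ball 0 1" using \<phi>(2) by (auto simp: K_def)
  ultimately obtain \<rho> where \<rho>: "0 < \<rho>" "\<rho> < 1" "\<phi> ` K \<subseteq> ball 0 \<rho>"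
    using compact_subset_ball_imp_smaller_ball zero_less_one by blast
  have big: "\<sigma> \<le> norm ((k \<circ> \<psi>) x)" if x: "\<rho> \<le> norm x" "norm x < 1" for x
  proof (rule ccontr)
    assume "\<not> ?thesis"
    then have "\<psi> x \<in> K" using \<psi>(2)[of x] x by (simp add: K_def)
    then have "\<phi> (\<psi> x) \<in> ball 0 \<rho>" using \<rho>(3) by blast
    with \<psi>(3)[of x] x show False by simp
  qed
  define W where "W = {x \<in> ball 0 1. (k \<circ> \<psi>) x = 0}"
  have inj: "inj_on \<psi> W" using \<psi>(3) unfolding W_def by (metis (no_types, lifting) inj_onI mem_Collect_eq)
  have "z \<in> \<psi> ` W" if "z \<in> Z" for z
    using that \<phi>(2,3)[of z] by (intro image_eqI[of _ _ "\<phi> z"]) (auto simp: W_def Z_def)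
  then have im: "\<psi> ` W = Z"
    using \<psi>(2) by (auto simp: W_def Z_def)
  have \<psi>_sub: "\<psi> ` ball 0 1 \<subseteq> \<Omega>" using \<psi>(2) by blast
  note holo = holomorphic_on_compose_gen[OF \<psi>(1) k \<psi>_sub] holomorphic_on_compose_gen[OF \<psi>(1) a \<psi>_sub]
  have smp: "deriv (k \<circ> \<psi>) x \<noteq> 0" if "norm x < 1" "(k \<circ> \<psi>) x = 0" for x
    using that dn[of x] dcomp[OF _ k, of x] simple[of "\<psi> x"] \<psi>(2)[of x] by simp
  have main: "finite W" "norm (\<Sum>x\<in>W. deriv (a \<circ> \<psi>) x / deriv (k \<circ> \<psi>) x) \<le> \<epsilon> * card W / \<tau>"
    unfolding W_def
    using norm_sum_deriv_quotient_zeros_le[OF holo \<rho>(1,2) big _ smp \<tau>, of \<epsilon>] ae \<psi>(2)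
    by (force simp: image_subset_iff)+
  show "finite Z" using main(1) im by blast
  have "(\<Sum>x\<in>W. deriv (a \<circ> \<psi>) x / deriv (k \<circ> \<psi>) x) = (\<Sum>x\<in>W. deriv a (\<psi> x) / deriv k (\<psi> x))"
    using dcomp k a dn by (intro sum.cong) (auto simp: W_def)
  also have "\<dots> = (\<Sum>z\<in>Z. deriv a z / deriv k z)"
    unfolding im[symmetric] using inj by (simp add: sum.reindex)
  finally show "norm (\<Sum>z\<in>Z. deriv a z / deriv k z) \<le> \<epsilon> * card Z / \<tau>"
    using main(2) card_image[OF inj] im by simp
qed

text \<open>Within the ball the image is open by the open mapping theorem and relatively closed by
  properness, and the ball is connected. A constant \<open>k\<close> is excluded because
  \<open>\<Omega>\<close> itself would be compact.\<close>

lemma ball_subset_image_if_proper: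
  fixes k :: "complex \<Rightarrow> complex"
  assumes "open \<Omega>" "connected \<Omega>" "k holomorphic_on \<Omega>"
    and proper: "\<And>\<tau>. \<tau> < T \<Longrightarrow> compact {z \<in> \<Omega>. norm (k z) \<le> \<tau>}"
    and z0: "z0 \<in> \<Omega>" "norm (k z0) < T"
  shows "ball 0 T \<subseteq> k ` \<Omega>"
proof -
  have nc: "\<not> k constant_on \<Omega>"
  proof
    assume "k constant_on \<Omega>"
    then have "{z \<in> \<Omega>. norm (k z) \<le> norm (k z0)} = \<Omega>"
      using z0(1) by (auto simp: constant_on_def)
    then have "compact \<Omega>" using proper[OF z0(2)] by simp
    then show False using \<open>open \<Omega>\<close> z0(1) compact_open by blast
  qed
  have "open (k ` \<Omega>)"
    using open_mapping_thm[OF assms(3,1,2) assms(1) order_refl nc] .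
  then have op: "openin (top_of_set (ball 0 T)) (ball 0 T \<inter> k ` \<Omega>)"
    by (simp add: openin_open_Int)
  have cl: "closedin (top_of_set (ball 0 T)) (ball 0 T \<inter> k ` \<Omega>)"
    unfolding closedin_limpt
  proof safe
    fix y assume y: "y islimpt ball 0 T \<inter> k ` \<Omega>" "y \<in> ball 0 T"
    \<comment> \<open>A radius strictly between \<open>norm y\<close> and \<open>T\<close>: values
      near \<open>y\<close> then come from one compact sublevel set, whose image is closed.\<close>
    define \<tau> where "\<tau> = (norm y + T) / 2"
    have \<tau>: "norm y < \<tau>" "\<tau> < T" using y(2) by (auto simp: \<tau>_def)
    have "compact (k ` {z \<in> \<Omega>. norm (k z) \<le> \<tau>})"
      using proper[OF \<tau>(2)] assms(3)
      by (intro compact_continuous_image holomorphic_on_imp_continuous_on)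
         (auto elim: holomorphic_on_subset)
    moreover have "y islimpt (ball 0 T \<inter> k ` \<Omega>) \<inter> ball 0 \<tau>"
      unfolding islimpt_def
    proof safe
      fix U assume "y \<in> U" "open U"
      then have "y \<in> U \<inter> ball 0 \<tau>" "open (U \<inter> ball 0 \<tau>)" using \<tau>(1) by auto
      then obtain x where "x \<in> ball 0 T \<inter> k ` \<Omega>" "x \<in> U \<inter> ball 0 \<tau>" "x \<noteq> y"
        using islimptE[OF y(1)] by metis
      then show "\<exists>x\<in>ball 0 T \<inter> k ` \<Omega> \<inter> ball 0 \<tau>. x \<in> U \<and> x \<noteq> y"
        by (meson IntD1 IntD2 IntI)
    qed
    then have "y islimpt k ` {z \<in> \<Omega>. norm (k z) \<le> \<tau>}"
      by (rule islimpt_subset) auto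
    ultimately have "y \<in> k ` {z \<in> \<Omega>. norm (k z) \<le> \<tau>}"
      using compact_imp_closed closed_limpt by blast
    then show "y \<in> k ` \<Omega>" by blast
  qed
  have "ball 0 T \<inter> k ` \<Omega> = {} \<or> ball 0 T \<inter> k ` \<Omega> = ball 0 T"
    using connected_clopen[THEN iffD1, OF connected_ball] op cl by blast
  then show ?thesis using z0 by auto
qed

subsection \<open>Lifting through a proper holomorphic map\<close>

lemma finite_separated_radius:
  fixes F :: "'a::metric_space set"
  assumes "finite F" "\<And>x. x \<in> F \<Longrightarrow> 0 < r x"
  obtains \<delta> :: real where "0 < \<delta>" "\<And>x. x \<in> F \<Longrightarrow> \<delta> \<le> r x"
    "\<And>x y. \<lbrakk>x \<in> F; y \<in> F; x \<noteq> y\<rbrakk> \<Longrightarrow> disjnt (ball x \<delta>) (ball y \<delta>)"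
proof -
  define D where "D = {(x, y) \<in> F \<times> F. x \<noteq> y}"
  \<comment> \<open>Half distances make the balls disjoint; the element 1 keeps \<open>B\<close>
    nonempty, so that \<open>Min B\<close> is meaningful also for empty \<open>F\<close>.\<close>
  define B where "B = insert 1 (r ` F \<union> (\<lambda>(x, y). dist x y / 2) ` D)"
  have "finite D" unfolding D_def by (rule finite_subset[of _ "F \<times> F"]) (use assms in auto)
  then have fin: "finite B" using assms(1) by (simp add: B_def)
  have pos: "\<forall>b\<in>B. 0 < b" using assms(2) by (auto simp: B_def D_def)
  have le: "Min B \<le> b" if "b \<in> B" for b using fin that by simp
  show ?thesis
  proof (rule that[of "Min B"])
    show "0 < Min B" using fin pos by (subst Min_gr_iff) (auto simp: B_def)
    show "Min B \<le> r x" if "x \<in> F" for x using that by (intro le) (simp add: B_def)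
    show "disjnt (ball x (Min B)) (ball y (Min B))" if "x \<in> F" "y \<in> F" "x \<noteq> y" for x y
    proof -
      have "(x, y) \<in> D" using that by (simp add: D_def)
      then have "Min B \<le> dist x y / 2" by (intro le) (force simp: B_def)
      then show ?thesis
        unfolding disjnt_def by (intro disjoint_ballI) simp
    qed
  qed
qed

text \<open>A proper local homeomorphism is a covering. Each fibre is finite, and small disks around
  its points serve as sheets once the images of all other nearby preimages are removed from the
  base.\<close>

lemma covering_space_proper_holomorphic:
  fixes h :: "complex \<Rightarrow> complex"
  assumes C: "open C" and S: "open S" and h: "h holomorphic_on C" "h ` C = S"
    and regular: "\<And>z. z \<in> C \<Longrightarrow> deriv h z \<noteq> 0"
    and proper: "\<And>K. \<lbrakk>compact K; K \<subseteq> S\<rbrakk> \<Longrightarrow> compact (C \<inter> h -` K)"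
  shows "covering_space C h S"
proof
  show conth: "continuous_on C h" using h(1) by (rule holomorphic_on_imp_continuous_on)
  show "h ` C = S" by fact
  fix y assume y: "y \<in> S"
  define F where "F = C \<inter> h -` {y}"
  have "\<forall>x\<in>C. \<exists>r>0. ball x r \<subseteq> C \<and> inj_on h (ball x r)"
    using has_complex_derivative_locally_injective[OF h(1) _ C regular] by metis
  then obtain r where r: "\<And>x. x \<in> C \<Longrightarrow> 0 < r x" "\<And>x. x \<in> C \<Longrightarrow> ball x (r x) \<subseteq> C"
    "\<And>x. x \<in> C \<Longrightarrow> inj_on h (ball x (r x))"
    by metis
  have "compact F" using proper[of "{y}"] y by (simp add: F_def)
  moreover have "F \<subseteq> (\<Union>x\<in>F. ball x (r x))" using r(1) by (auto simp: F_def)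
  ultimately obtain D where D: "D \<subseteq> F" "finite D" "F \<subseteq> (\<Union>x\<in>D. ball x (r x))"
    using compactE_image[of F F "\<lambda>x. ball x (r x)"] open_ball by metis
  \<comment> \<open>As \<open>h\<close> is injective on each ball, a ball meets the fibre only in
    its centre; hence a finite subcover already uses every point of the fibre.\<close>
  have "F \<subseteq> D"
  proof
    fix z assume z: "z \<in> F"
    then obtain x where x: "x \<in> D" "z \<in> ball x (r x)" using D by blast
    then have "x \<in> C" "h x = h z" "x \<in> ball x (r x)" using D(1) z r(1) by (auto simp: F_def)
    then have "x = z" using r(3) x(2) by (metis inj_onD)
    then show "z \<in> D" using x by simp
  qed
  then have "finite F" using D finite_subset by blast
  then obtain \<delta> where \<delta>: "0 < \<delta>" "\<And>x. x \<in> F \<Longrightarrow> \<delta> \<le> r x"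
    "\<And>x y. \<lbrakk>x \<in> F; y \<in> F; x \<noteq> y\<rbrakk> \<Longrightarrow> disjnt (ball x \<delta>) (ball y \<delta>)"
    by (rule finite_separated_radius[of F r]) (use r(1) in \<open>auto simp: F_def\<close>)
  have ball_r: "ball x \<delta> \<subseteq> ball x (r x)" if "x \<in> F" for x
    using \<delta>(2)[OF that] by (rule subset_ball)
  have ball_C: "ball x \<delta> \<subseteq> C" if "x \<in> F" for x
    using ball_r[OF that] r(2)[of x] that unfolding F_def by blast
  have inj: "inj_on h (ball x \<delta>)" if "x \<in> F" for x
    using inj_on_subset[OF r(3) ball_r] that unfolding F_def by blast
  have open_im: "open (h ` U)" if "open U" "U \<subseteq> ball x \<delta>" "x \<in> F" for U x
  proof (rule open_mapping_thm3)
    show "h holomorphic_on U" using that(2) ball_C[OF that(3)] h(1) by (meson holomorphic_on_subset)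
    show "inj_on h U" using inj[OF that(3)] that(2) by (rule inj_on_subset)
  qed fact
  obtain e where e: "0 < e" "cball y e \<subseteq> S"
    using S y open_contains_cball by blast
  \<comment> \<open>The points over a closed disk around \<open>y\<close> that lie outside all
    sheets. The image of this compact set is closed and omits \<open>y\<close>, so it can be cut out
    of the neighbourhood \<open>T\<close>.\<close>
  define L where "L = C \<inter> h -` cball y e - (\<Union>x\<in>F. ball x \<delta>)"
  have "compact L"
    unfolding L_def using proper[OF compact_cball e(2)] by (intro compact_diff) auto
  then have "closed (h ` L)"
    using conth by (intro compact_imp_closed compact_continuous_image)
      (auto simp: L_def elim: continuous_on_subset)
  define T where "T = ball y e \<inter> (\<Inter>x\<in>F. h ` ball x \<delta>) - h ` L"
  have openT: "open T"
    unfolding T_def using \<open>closed (h ` L)\<close> \<open>finite F\<close> open_im by (intro open_Diff open_Int open_INT) auto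
  have TS: "T \<subseteq> S" using e(2) unfolding T_def by (meson Diff_subset IntD1 ball_subset_cball order_trans subsetI subset_iff)
  have "y \<notin> h ` L"
  proof
    assume "y \<in> h ` L"
    then obtain z where "z \<in> F" "z \<notin> (\<Union>x\<in>F. ball x \<delta>)" unfolding L_def F_def by blast
    then show False using \<delta>(1) by (meson UN_I centre_in_ball)
  qed
  moreover have "y \<in> h ` ball x \<delta>" if "x \<in> F" for x
    using \<delta>(1) that by (intro image_eqI[of _ _ x]) (auto simp: F_def)
  ultimately have yT: "y \<in> T" using e(1) by (simp add: T_def)
  define V where "V = (\<lambda>x. ball x \<delta> \<inter> h -` T)"
  have openV: "open (V x)" if "x \<in> F" for x
    unfolding V_def using continuous_on_subset[OF conth ball_C[OF that]] openT
    by (intro continuous_open_preimage) auto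
  have "\<Union> (V ` F) = C \<inter> h -` T"
  proof
    show "\<Union> (V ` F) \<subseteq> C \<inter> h -` T" using ball_C unfolding V_def by blast
    show "C \<inter> h -` T \<subseteq> \<Union> (V ` F)"
    proof
      fix z assume z: "z \<in> C \<inter> h -` T"
      then have "z \<notin> L" "h z \<in> cball y e"
        unfolding T_def by (blast, metis IntD1 DiffD1 IntD2 ball_subset_cball subsetD vimageD)
      then have "z \<in> (\<Union>x\<in>F. ball x \<delta>)" using z unfolding L_def by blast
      then show "z \<in> \<Union> (V ` F)" using z unfolding V_def by blast
    qed
  qed
  moreover have "\<forall>u\<in>V ` F. openin (top_of_set C) u"
    using openV ball_C C unfolding V_def by (auto intro: open_subset)
  moreover have "pairwise disjnt (V ` F)"
  proof (rule pairwise_imageI)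
    fix x x' assume "x \<in> F" "x' \<in> F" "x \<noteq> x'"
    then have "disjnt (ball x \<delta>) (ball x' \<delta>)" by (rule \<delta>(3))
    then show "disjnt (V x) (V x')" unfolding V_def disjnt_def by blast
  qed
  moreover have "\<exists>q. homeomorphism (V x) T h q" if x: "x \<in> F" for x
  proof (rule homeomorphism_injective_open_map[of "V x" h T])
    show "continuous_on (V x) h"
      using continuous_on_subset[OF conth ball_C[OF x]] unfolding V_def
      by (rule continuous_on_subset) blast
    have "T \<subseteq> h ` ball x \<delta>" using x unfolding T_def by blast
    then show "h ` V x = T" unfolding V_def by blast
    show "inj_on h (V x)" using inj[OF x] unfolding V_def by (rule inj_on_subset) blast
    show "openin (top_of_set T) (h ` U)" if "openin (top_of_set (V x)) U" for U
    proof -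
      have U: "open U" "U \<subseteq> V x"
        using that openV[OF x] openin_open_eq by blast+
      then have "open (h ` U)" using open_im[OF _ _ x] unfolding V_def by blast
      moreover have "h ` U \<subseteq> T" using U(2) unfolding V_def by blast
      ultimately show ?thesis by (simp add: open_subset)
    qed
  qed blast
  ultimately show "\<exists>T. y \<in> T \<and> openin (top_of_set S) T \<and>
      (\<exists>v. \<Union>v = C \<inter> h -` T \<and> (\<forall>u\<in>v. openin (top_of_set C) u) \<and> pairwise disjnt v \<and>
           (\<forall>u\<in>v. \<exists>q. homeomorphism u T h q))"
    using yT openT TS by (intro exI[of _ T] conjI exI[of _ "V ` F"]) (auto intro: open_subset)
qed

text \<open>The Schwarz lemma in a Riemann coordinate centred at \<open>p\<close>. Since the image
  of \<open>g\<close> lies in a compact set, the conjugated map can be divided by some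
  \<open>\<rho> < 1\<close> and still maps the disk into itself, which makes the inequality
  strict.\<close>

lemma norm_deriv_less_1_if_fixed_point:
  assumes \<Omega>: "open \<Omega>" "simply_connected \<Omega>" "bounded \<Omega>" and g: "g holomorphic_on \<Omega>"
    and K: "compact K" "K \<subseteq> \<Omega>" "g ` \<Omega> \<subseteq> K" and p: "p \<in> \<Omega>" "g p = p"
  shows "norm (deriv g p) < 1"
proof -
  from normalized_Riemann_map[OF \<Omega> p(1)] obtain \<phi> \<psi> where
    \<phi>: "\<phi> holomorphic_on \<Omega>" "\<And>z. z \<in> \<Omega> \<Longrightarrow> \<phi> z \<in> ball 0 1" "\<And>z. z \<in> \<Omega> \<Longrightarrow> \<psi> (\<phi> z) = z" and
    \<psi>: "\<psi> holomorphic_on ball 0 1" "\<And>x. x \<in> ball 0 1 \<Longrightarrow> \<psi> x \<in> \<Omega>" "\<And>x. x \<in> ball 0 1 \<Longrightarrow> \<phi> (\<psi> x) = x"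
    and \<phi>p: "\<phi> p = 0"
    by metis
  have \<psi>0: "\<psi> 0 = p" using \<phi>(3)[OF p(1)] \<phi>p by simp
  have "compact (\<phi> ` K)"
    using K(1,2) holomorphic_on_imp_continuous_on[OF \<phi>(1)]
    by (auto intro: compact_continuous_image elim: continuous_on_subset)
  moreover have "\<phi> ` K \<subseteq> ball 0 1" using K(2) \<phi>(2) by blast
  ultimately obtain \<rho> where \<rho>: "0 < \<rho>" "\<rho> < 1" "\<phi> ` K \<subseteq> ball 0 \<rho>"
    using compact_subset_ball_imp_smaller_ball zero_less_one by blast
  define G where "G = (\<lambda>x. \<phi> (g (\<psi> x)) / of_real \<rho>)"
  have gim: "g ` \<Omega> \<subseteq> \<Omega>" using K by blast
  have comp: "\<phi> \<circ> (g \<circ> \<psi>) holomorphic_on ball 0 1"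
    by (rule holomorphic_on_compose_gen[OF holomorphic_on_compose_gen[OF \<psi>(1) g] \<phi>(1)])
       (use \<psi>(2) gim in auto)
  have "norm (deriv G 0) \<le> 1"
  proof (rule Schwarz_Lemma(2))
    show "G holomorphic_on ball 0 1"
      unfolding G_def using comp \<rho>(1) by (intro holomorphic_intros) (auto simp: o_def)
    show "G 0 = 0" using \<psi>0 p \<phi>p by (simp add: G_def)
    show "norm (G z) < 1" if "norm z < 1" for z
    proof -
      have "\<phi> (g (\<psi> z)) \<in> ball 0 \<rho>" using \<rho>(3) K(3) \<psi>(2)[of z] that
        by (meson image_subset_iff mem_ball_0)
      then show ?thesis using \<rho>(1) by (simp add: G_def norm_divide)
    qed
    show "norm (0 :: complex) < 1" by simp
  qed
  moreover have "deriv G 0 = deriv g p / of_real \<rho>"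
  proof -
    have "(\<psi> has_field_derivative deriv \<psi> 0) (at 0)"
      by (rule holomorphic_derivI[OF \<psi>(1)]) auto
    moreover have "(g has_field_derivative deriv g p) (at (\<psi> 0))"
      unfolding \<psi>0 by (rule holomorphic_derivI[OF g \<Omega>(1) p(1)])
    moreover have "(\<phi> has_field_derivative deriv \<phi> p) (at (g (\<psi> 0)))"
      unfolding \<psi>0 p(2) by (rule holomorphic_derivI[OF \<phi>(1) \<Omega>(1) p(1)])
    ultimately have "((\<lambda>x. \<phi> (g (\<psi> x))) has_field_derivative deriv \<phi> p * (deriv g p * deriv \<psi> 0)) (at 0)"
      by (intro DERIV_chain2[of \<phi>] DERIV_chain2[of g])
    moreover have "deriv \<phi> p * deriv \<psi> 0 = 1"
      using deriv_mult_eq_1_if_left_inverse[OF \<phi>(1) \<Omega>(1) \<psi>(1) open_ball _ \<psi>(2,3), of 0] \<psi>0 by simp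
    then have "deriv \<phi> p * (deriv g p * deriv \<psi> 0) = deriv g p"
      by (metis mult.commute mult.left_commute mult.right_neutral)
    ultimately have "((\<lambda>x. \<phi> (g (\<psi> x))) has_field_derivative deriv g p) (at 0)" by simp
    then show ?thesis
      unfolding G_def by (intro DERIV_imp_deriv DERIV_cdivide)
  qed
  ultimately show ?thesis using \<rho> by (simp add: norm_divide)
qed

lemma norm_deriv_less_at_coincidence:
  fixes h w :: "complex \<Rightarrow> complex"
  assumes \<Omega>: "open \<Omega>" "simply_connected \<Omega>" "bounded \<Omega>"
    and h: "h holomorphic_on \<Omega>" and w: "w holomorphic_on \<Omega>" "inj_on w \<Omega>"
    and we: "\<And>z. z \<in> \<Omega> \<Longrightarrow> norm (w z) \<le> \<epsilon>" "\<epsilon> < M"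
    and proper: "\<And>\<tau>. \<tau> < M \<Longrightarrow> compact {z \<in> \<Omega>. norm (h z) \<le> \<tau>}"
    and regular: "\<And>z. \<lbrakk>z \<in> \<Omega>; h z \<in> w ` \<Omega>\<rbrakk> \<Longrightarrow> deriv h z \<noteq> 0"
    and p: "p \<in> \<Omega>" "h p = w p"
  shows "norm (deriv w p) < norm (deriv h p)"
proof -
  define K where "K = {z \<in> \<Omega>. norm (h z) \<le> \<epsilon>}"
  have K: "compact K" "K \<subseteq> \<Omega>" using proper[OF we(2)] by (auto simp: K_def)
  define C where "C = \<Omega> \<inter> h -` (w ` \<Omega>)"
  have conth: "continuous_on \<Omega> h" using h by (rule holomorphic_on_imp_continuous_on)
  have ow: "open (w ` \<Omega>)" by (rule open_mapping_thm3[OF w(1) \<Omega>(1) w(2)])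
  have oC: "open C" unfolding C_def by (rule continuous_open_preimage[OF conth \<Omega>(1) ow])
  have hC: "h holomorphic_on C" using h by (rule holomorphic_on_subset) (auto simp: C_def)
  have "ball 0 M \<subseteq> h ` \<Omega>"
    by (rule ball_subset_image_if_proper[OF \<Omega>(1) simply_connected_imp_connected[OF \<Omega>(2)] h proper p(1)])
       (use we(1)[OF p(1)] we(2) p(2) in auto)
  moreover have "w ` \<Omega> \<subseteq> ball 0 M" using we by force
  ultimately have "w ` \<Omega> \<subseteq> h ` \<Omega>" by (meson order_trans)
  moreover have "h ` (\<Omega> \<inter> h -` B) = h ` \<Omega> \<inter> B" for B by blast
  ultimately have im: "h ` C = w ` \<Omega>" unfolding C_def by (simp add: Int_absorb1)
  have CK: "C \<subseteq> K" using we(1) unfolding C_def K_def by auto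
  have cov: "covering_space C h (w ` \<Omega>)"
  proof (rule covering_space_proper_holomorphic[OF oC ow hC im])
    show "deriv h z \<noteq> 0" if "z \<in> C" for z using regular that unfolding C_def by blast
    fix L assume L: "compact L" "L \<subseteq> w ` \<Omega>"
    \<comment> \<open>The set \<open>C\<close> is only known to be open, so compactness is obtained
      by writing the preimage inside the compact set \<open>K\<close>, where it is closed.\<close>
    have "C \<inter> h -` L = K \<inter> h -` L" using CK L(2) K(2) unfolding C_def by blast
    moreover have "closed (K \<inter> h -` L)"
      using continuous_on_subset[OF conth K(2)] compact_imp_closed K(1) L(1)
      by (intro continuous_closed_preimage) auto
    ultimately show "compact (C \<inter> h -` L)"
      using K(1) by (metis compact_Int_closed inf_left_idem)
  qed
  have pC: "p \<in> C" using p unfolding C_def by blast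
  obtain g where g: "continuous_on \<Omega> g" "g \<in> \<Omega> \<rightarrow> C" "g p = p" "\<And>z. z \<in> \<Omega> \<Longrightarrow> h (g z) = w z"
    using covering_space_lift_strong[OF cov pC p(1) \<Omega>(2) open_imp_locally_path_connected[OF \<Omega>(1)]
        holomorphic_on_imp_continuous_on[OF w(1)] _ p(2)[symmetric]] by blast
  have hg: "g holomorphic_on \<Omega>"
    by (rule covering_space_lift_is_holomorphic[OF cov oC hC w(1) _ g(2,1,4)]) auto
  have "norm (deriv g p) < 1"
    by (rule norm_deriv_less_1_if_fixed_point[OF \<Omega> hg K _ p(1) g(3)]) (use g(2) CK in auto)
  moreover have "deriv w p = deriv h p * deriv g p"
  proof -
    have "(h has_field_derivative deriv h p) (at (g p))"
      using holomorphic_derivI[OF h \<Omega>(1) p(1)] g(3) by simp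
    then have "((\<lambda>z. h (g z)) has_field_derivative deriv h p * deriv g p) (at p)"
      using holomorphic_derivI[OF hg \<Omega>(1) p(1)] by (rule DERIV_chain2)
    then have "(w has_field_derivative deriv h p * deriv g p) (at p)"
      by (rule has_field_derivative_transform_within_open[OF _ \<Omega>(1) p(1)]) (use g(4) in simp)
    then show ?thesis by (rule DERIV_imp_deriv)
  qed
  moreover have "deriv h p \<noteq> 0" using regular p by blast
  ultimately show ?thesis by (simp add: norm_mult)
qed

subsection \<open>Sublevel sets of entire functions\<close>

text \<open>By the maximum principle \<open>norm h\<close> has no local maximum, so each point of
  the level set is a limit of points with larger modulus. This turns the boundary in the definition
  of a Baker omitted value into a level set.\<close>

lemma frontier_superlevel_set:
  assumes h: "h holomorphic_on UNIV" and nc: "\<not> h constant_on UNIV"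
  shows "frontier {z. M < norm (h z)} = {z. norm (h z) = M}"
proof -
  have cont: "continuous_on UNIV (\<lambda>z. norm (h z))"
    by (intro continuous_intros holomorphic_on_imp_continuous_on h)
  have op: "open {z. M < norm (h z)}"
    by (intro open_Collect_less continuous_intros cont)
  have cl: "closed {z. M \<le> norm (h z)}"
    by (intro closed_Collect_le continuous_intros cont)
  have "closure {z. M < norm (h z)} \<subseteq> {z. M \<le> norm (h z)}"
    by (rule closure_minimal[OF _ cl]) auto
  moreover have "z \<in> closure {z. M < norm (h z)}" if z: "norm (h z) = M" for z
  proof (rule ccontr)
    assume "z \<notin> closure {z. M < norm (h z)}"
    then have "z \<in> - closure {z. M < norm (h z)}" "open (- closure {z. M < norm (h z)})" by auto
    moreover have "\<forall>w \<in> - closure {z. M < norm (h z)}. norm (h w) \<le> norm (h z)"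
    proof
      fix w assume "w \<in> - closure {z. M < norm (h z)}"
      then have "w \<notin> {z. M < norm (h z)}"
        using closure_subset by (metis ComplD subsetD)
      then show "norm (h w) \<le> norm (h z)" using z by simp
    qed
    ultimately have "h constant_on UNIV"
      using maximum_modulus_principle[OF h open_UNIV connected_UNIV _ subset_UNIV] by blast
    then show False using nc by blast
  qed
  ultimately show ?thesis
    unfolding frontier_def using op by (auto simp: interior_open)
qed

text \<open>The maximum principle fills in loops: on a loop in \<open>\<Omega>\<close> the maximum
  of \<open>norm h\<close> is below \<open>M\<close> and bounds \<open>norm h\<close> inside the
  loop too. So the inside belongs to the same component, and the winding number around points off
  \<open>\<Omega>\<close> is 0.\<close>

lemma simply_connected_component_sublevel_set:
  assumes h: "h holomorphic_on UNIV" and \<Omega>: "\<Omega> \<in> components {z. norm (h z) < M}"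
  shows "open \<Omega>" "simply_connected \<Omega>" "frontier \<Omega> \<subseteq> {z. norm (h z) = M}"
proof -
  have cont: "continuous_on UNIV (\<lambda>z. norm (h z))"
    by (intro continuous_intros holomorphic_on_imp_continuous_on h)
  have op: "open {z. norm (h z) < M}"
    by (intro open_Collect_less continuous_intros cont)
  show o\<Omega>: "open \<Omega>" using open_components[OF op \<Omega>] .
  have c\<Omega>: "connected \<Omega>" using in_components_connected[OF \<Omega>] .
  show "simply_connected \<Omega>"
    unfolding simply_connected_eq_winding_number_zero[OF o\<Omega>]
  proof (intro conjI allI impI)
    show "connected \<Omega>" by fact
    fix g z
    assume g: "path g \<and> path_image g \<subseteq> \<Omega> \<and> pathfinish g = pathstart g \<and> z \<notin> \<Omega>"
    define P where "P = path_image g"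
    have P: "compact P" "connected P" "P \<noteq> {}" "P \<subseteq> \<Omega>"
      using g by (auto simp: P_def compact_path_image connected_path_image)
    have cP: "closed P" using P(1) by (rule compact_imp_closed)
    obtain x where x: "x \<in> P" "\<And>y. y \<in> P \<Longrightarrow> norm (h y) \<le> norm (h x)"
      using continuous_attains_sup[OF P(1,3), of "\<lambda>z. norm (h z)"] cont continuous_on_subset by blast
    have le: "norm (h y) \<le> norm (h x)" if "y \<in> inside P" for y
    proof (rule maximum_modulus_frontier[of h "inside P"])
      show "h holomorphic_on interior (inside P)" using h holomorphic_on_subset by blast
      show "continuous_on (closure (inside P)) h"
        using holomorphic_on_imp_continuous_on[OF h] continuous_on_subset by blast
      show "bounded (inside P)" using P(1) by (simp add: bounded_inside compact_imp_bounded)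
      show "norm (h w) \<le> norm (h x)" if "w \<in> frontier (inside P)" for w
        using that x(2) frontier_inside_subset[OF cP] by blast
    qed fact
    have "x \<in> {z. norm (h z) < M}" using x(1) P(4) in_components_subset[OF \<Omega>] by blast
    then have "P \<union> inside P \<subseteq> {z. norm (h z) < M}"
      using le x(2) by fastforce
    moreover have "connected (P \<union> inside P)" using connected_with_inside cP P(2) by blast
    moreover have "\<Omega> \<inter> (P \<union> inside P) \<noteq> {}" using P(3,4) by blast
    ultimately have "P \<union> inside P \<subseteq> \<Omega>" using components_maximal[OF \<Omega>] by blast
    then have "z \<in> outside P" using g inside_Un_outside[of P] by blast
    then show "winding_number g z = 0"
      using g by (intro winding_number_zero_in_outside) (auto simp: P_def)
  qed
  have "frontier {z. norm (h z) < M} \<subseteq> {z. norm (h z) = M}"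
  proof -
    have "closure {z. norm (h z) < M} \<subseteq> {z. norm (h z) \<le> M}"
      by (rule closure_minimal) (auto intro!: closed_Collect_le continuous_intros cont)
    then show ?thesis unfolding frontier_def using op by (auto simp: interior_open)
  qed
  then show "frontier \<Omega> \<subseteq> {z. norm (h z) = M}"
    using frontier_of_components_subset[OF \<Omega>] by blast
qed

text \<open>On the frontier of \<open>\<Omega>\<close> the modulus equals \<open>M > \<tau>\<close>,
  so the set stays away from it and is closed. In other words, \<open>h\<close> is proper from
  \<open>\<Omega>\<close> to the disk of radius \<open>M\<close>.\<close>

lemma compact_component_sublevel_set:
  assumes h: "h holomorphic_on UNIV" and \<Omega>: "\<Omega> \<in> components {z. norm (h z) < M}" "bounded \<Omega>"
    and "\<tau> < M"
  shows "compact {z \<in> \<Omega>. norm (h z) \<le> \<tau>}"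
proof -
  have "closed {z. norm (h z) \<le> \<tau>}"
    by (intro closed_Collect_le continuous_intros holomorphic_on_imp_continuous_on h)
  then have "closed (closure \<Omega> \<inter> {z. norm (h z) \<le> \<tau>})" by blast
  moreover have "closure \<Omega> \<inter> {z. norm (h z) \<le> \<tau>} = {z \<in> \<Omega>. norm (h z) \<le> \<tau>}"
  proof -
    have "z \<in> \<Omega>" if "z \<in> closure \<Omega>" "norm (h z) \<le> \<tau>" for z
    proof -
      have "z \<notin> frontier \<Omega>"
        using simply_connected_component_sublevel_set(3)[OF h \<Omega>(1)] \<open>\<tau> < M\<close> that(2) by auto
      then show ?thesis using that(1) closure_Un_frontier[of \<Omega>] by blast
    qed
    then show ?thesis using closure_subset by blast
  qed
  ultimately show ?thesis
    using \<Omega>(2) by (simp add: compact_eq_bounded_closed bounded_subset)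
qed

text \<open>An unbounded simply connected domain has only unbounded frontier components, whereas
  here they sit inside bounded components of the level set. Liouville's theorem excludes an empty
  frontier.\<close>

lemma bounded_component_sublevel_set:
  assumes h: "h holomorphic_on UNIV" and nc: "\<not> h constant_on UNIV"
    and bd: "\<And>C. C \<in> components {z. norm (h z) = M} \<Longrightarrow> bounded C"
    and \<Omega>: "\<Omega> \<in> components {z. norm (h z) < M}"
  shows "bounded \<Omega>"
proof (rule ccontr)
  assume unb: "\<not> bounded \<Omega>"
  note sc = simply_connected_component_sublevel_set[OF h \<Omega>]
  have "\<forall>C\<in>components (frontier \<Omega>). \<not> bounded C"
    using simply_connected_eq_frontier_properties[OF sc(1)] sc(2) unb by simp
  moreover have "frontier \<Omega> \<noteq> {}"
  proof
    assume "frontier \<Omega> = {}"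
    then have "\<Omega> = UNIV" using \<Omega> frontier_eq_empty[of \<Omega>] in_components_nonempty by blast
    then have "range h \<subseteq> ball 0 M" using in_components_subset[OF \<Omega>] by auto
    then have "bounded (range h)" using bounded_ball bounded_subset by blast
    then show False using Liouville_theorem[OF h] nc unfolding constant_on_def by metis
  qed
  then obtain C where C: "C \<in> components (frontier \<Omega>)" by (meson all_not_in_conv components_eq_empty)
  ultimately have "\<not> bounded C" by blast
  moreover have "C \<subseteq> {z. norm (h z) = M}" using in_components_subset[OF C] sc(3) by blast
  then obtain C' where "C' \<in> components {z. norm (h z) = M}" "C \<subseteq> C'"
    using exists_component_superset in_components_connected[OF C] in_components_nonempty[OF C]
    by (metis subset_empty)
  ultimately show False using bd bounded_subset by blast
qed

text \<open>Makes the boundedness of components uniform. By the Sura-Bura theorem each component of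
  \<open>F\<close> lies in a compact, relatively open subset of \<open>F\<close>; finitely many of
  these cover \<open>F \<inter> K\<close>, and a connected subset of \<open>F\<close> meeting their
  clopen union stays in it.\<close>

lemma connected_subsets_meeting_compact_bounded:
  fixes F :: "'a::euclidean_space set"
  assumes "closed F" "\<And>C. C \<in> components F \<Longrightarrow> bounded C" "compact K"
  obtains N where "bounded N" "\<And>A. \<lbrakk>connected A; A \<subseteq> F; A \<inter> K \<noteq> {}\<rbrakk> \<Longrightarrow> A \<subseteq> N"
proof -
  have "\<exists>N. openin (top_of_set F) N \<and> compact N \<and> x \<in> N" if x: "x \<in> F" for x
  proof -
    define C where "C = connected_component_set F x"
    have C: "C \<in> components F" "x \<in> C" using x by (auto simp: C_def components_def)
    then have "compact C"
      using assms closed_components compact_eq_bounded_closed by blast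
    then obtain N where "openin (top_of_set F) N" "compact N" "C \<subseteq> N"
      using Sura_Bura_clopen_subset[OF closed_imp_locally_compact[OF assms(1)] C(1) _ open_UNIV]
        subset_UNIV by metis
    then show ?thesis using C(2) by blast
  qed
  then obtain N where N: "\<And>x. x \<in> F \<Longrightarrow> openin (top_of_set F) (N x)"
    "\<And>x. x \<in> F \<Longrightarrow> compact (N x)" "\<And>x. x \<in> F \<Longrightarrow> x \<in> N x"
    by metis
  then have "\<forall>x\<in>F. \<exists>V. open V \<and> N x = F \<inter> V" by (metis openin_open)
  then obtain V where V: "\<And>x. x \<in> F \<Longrightarrow> open (V x)" "\<And>x. x \<in> F \<Longrightarrow> N x = F \<inter> V x" by metis
  have "compact (F \<inter> K)" using assms(1,3) by (rule closed_Int_compact)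
  moreover have "F \<inter> K \<subseteq> (\<Union>x\<in>F \<inter> K. V x)" using N(3) V(2) by blast
  ultimately obtain D where D: "D \<subseteq> F \<inter> K" "finite D" "F \<inter> K \<subseteq> (\<Union>x\<in>D. V x)"
    using compactE_image[of "F \<inter> K" "F \<inter> K" V] V(1) by (metis IntD1)
  define U where "U = (\<Union>x\<in>D. N x)"
  have cU: "compact U" unfolding U_def using D N(2) by (intro compact_UN) auto
  have oU: "openin (top_of_set F) U" unfolding U_def using D(1) N(1) by (intro openin_Union) auto
  have FK: "F \<inter> K \<subseteq> U" using D V(2) unfolding U_def by blast
  show ?thesis
  proof (rule that)
    show "bounded U" using cU by (rule compact_imp_bounded)
    fix A assume A: "connected A" "A \<subseteq> F" "A \<inter> K \<noteq> {}"
    obtain W where W: "open W" "U = F \<inter> W" using oU by (auto simp: openin_open)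
    then have "A \<inter> U = A \<inter> W" using A(2) by blast
    then have "openin (top_of_set A) (A \<inter> U)" using W(1) by (simp add: openin_open_Int)
    moreover have "closedin (top_of_set A) (A \<inter> U)"
      using cU by (simp add: closedin_closed_Int compact_imp_closed)
    ultimately have "A \<inter> U = {} \<or> A \<inter> U = A"
      using A(1) connected_clopen by blast
    moreover have "A \<inter> U \<noteq> {}" using A FK by blast
    ultimately show "A \<subseteq> U" by blast
  qed
qed

text \<open>The complement of the disk is connected and not contained in the bounded set
  \<open>S\<close>; if it met \<open>S\<close>, it would also meet the frontier of
  \<open>S\<close>.\<close>

lemma subset_cball_if_frontier_subset:
  fixes S :: "complex set"
  assumes "bounded S" "frontier S \<subseteq> cball b r"
  shows "S \<subseteq> cball b r"
proof (rule ccontr)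
  assume "\<not> ?thesis"
  then have "- cball b r \<inter> S \<noteq> {}" by blast
  moreover have "- cball b r - S \<noteq> {}"
  proof
    assume "- cball b r - S = {}"
    then have "UNIV = cball b r \<union> S" by blast
    then show False using assms(1) by (metis bounded_Un bounded_cball not_bounded_UNIV)
  qed
  moreover have "connected (- cball b r)"
    by (rule connected_complement_bounded_convex) auto
  ultimately have "- cball b r \<inter> frontier S \<noteq> {}" by (intro connected_Int_frontier)
  then show False using assms(2) by blast
qed

text \<open>Take the component of a very distant point \<open>z\<close>. If it met the disk, then
  either its connected frontier would meet the disk, so that it lies in \<open>N\<close> and traps
  the component near \<open>b\<close>, or the component would contain the disk and hence be that of
  \<open>b\<close>. Both contradict the choice of \<open>z\<close>.\<close>

lemma far_component_sublevel_set:
  assumes h: "h holomorphic_on UNIV" and nc: "\<not> h constant_on UNIV"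
    and bd: "\<And>C. C \<in> components {z. norm (h z) = M} \<Longrightarrow> bounded C"
    and unb: "\<not> bounded {z. norm (h z) < M}" and "0 \<le> R"
  obtains \<Omega> where "\<Omega> \<in> components {z. norm (h z) < M}" "bounded \<Omega>" "\<Omega> \<inter> cball b R = {}"
proof -
  \<comment> \<open>This set is empty when \<open>M \<le> norm (h b)\<close>, and then trivially
    bounded.\<close>
  define \<Omega>0 where "\<Omega>0 = connected_component_set {z. norm (h z) < M} b"
  have "\<Omega>0 = {} \<or> \<Omega>0 \<in> components {z. norm (h z) < M}"
    unfolding \<Omega>0_def components_def
    by (cases "norm (h b) < M") (auto simp only: connected_component_eq_empty mem_Collect_eq)
  then have b0: "bounded \<Omega>0" using bounded_component_sublevel_set[OF h nc bd] by auto
  have "closed {z. norm (h z) = M}"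
    by (intro closed_Collect_eq continuous_intros holomorphic_on_imp_continuous_on h)
  then obtain N where N: "bounded N"
    "\<And>A. \<lbrakk>connected A; A \<subseteq> {z. norm (h z) = M}; A \<inter> cball b R \<noteq> {}\<rbrakk> \<Longrightarrow> A \<subseteq> N"
    using connected_subsets_meeting_compact_bounded[OF _ bd compact_cball] by metis
  have "bounded (N \<union> \<Omega>0)" using N(1) b0 by simp
  then obtain r where "\<forall>y\<in>N \<union> \<Omega>0. dist b y \<le> r" using bounded_any_center by blast
  then have r: "N \<union> \<Omega>0 \<subseteq> cball b r" by auto
  obtain z where z: "norm (h z) < M" "z \<notin> cball b r"
    using unb bounded_cball bounded_subset by (metis (mono_tags, lifting) mem_Collect_eq subsetI)
  define \<Omega> where "\<Omega> = connected_component_set {z. norm (h z) < M} z"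
  have \<Omega>: "\<Omega> \<in> components {z. norm (h z) < M}" "z \<in> \<Omega>"
    using z(1) by (auto simp: \<Omega>_def components_def)
  have b\<Omega>: "bounded \<Omega>" using bounded_component_sublevel_set[OF h nc bd \<Omega>(1)] .
  note sc = simply_connected_component_sublevel_set[OF h \<Omega>(1)]
  have "\<Omega> \<inter> cball b R = {}"
  proof (rule ccontr)
    assume meet: "\<Omega> \<inter> cball b R \<noteq> {}"
    have "frontier \<Omega> \<inter> cball b R = {}"
    proof (rule ccontr)
      assume *: "frontier \<Omega> \<inter> cball b R \<noteq> {}"
      have "connected (frontier \<Omega>)"
        using simply_connected_eq_frontier_properties[OF sc(1)] sc(2) b\<Omega> by simp
      then have "frontier \<Omega> \<subseteq> N" using N(2) sc(3) * by blast
      then have "frontier \<Omega> \<subseteq> cball b r" using r by blast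
      then have "\<Omega> \<subseteq> cball b r" by (rule subset_cball_if_frontier_subset[OF b\<Omega>])
      then show False using \<Omega>(2) z(2) by blast
    qed
    then have "cball b R - \<Omega> = {}"
      using connected_Int_frontier[OF connected_cball, of b R \<Omega>] meet by blast
    then have "b \<in> \<Omega>" using \<open>0 \<le> R\<close> by auto
    then have "\<Omega> = \<Omega>0" unfolding \<Omega>_def \<Omega>0_def using connected_component_eq by metis
    then show False using \<Omega>(2) z(2) r by blast
  qed
  then show ?thesis using that \<Omega>(1) b\<Omega> by blast
qed

subsection \<open>The reciprocal of a function with an omitted value\<close>

text \<open>The value that \<open>f\<close> takes at a pole carries no information, so the limit 0
  of the reciprocal is prescribed there; for an omitted value \<open>b\<close> this removes the
  singularity.\<close>

definition bov_reciprocal :: "(complex \<Rightarrow> complex) \<Rightarrow> complex \<Rightarrow> complex \<Rightarrow> complex" where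
  "bov_reciprocal f b z = (if z \<in> poles f then 0 else 1 / (f z - b))"

lemma bov_reciprocal_eq_0_iff:
  "omitted_value f b \<Longrightarrow> bov_reciprocal f b z = 0 \<longleftrightarrow> z \<in> poles f"
  by (auto simp: bov_reciprocal_def omitted_value_def)

lemma eq_bov_reciprocal:
  "\<lbrakk>omitted_value f b; z \<notin> poles f\<rbrakk> \<Longrightarrow> f z = b + 1 / bov_reciprocal f b z"
  by (auto simp: bov_reciprocal_def omitted_value_def)

lemma punctured_analytic_if_transcendental_meromorphic:
  assumes "transcendental_meromorphic f"
  obtains r where "0 < r" "f holomorphic_on ball z r - {z}" "(ball z r - {z}) \<inter> poles f = {}"
proof -
  have "f meromorphic_on {z}"
    using assms unfolding transcendental_meromorphic_def by (meson meromorphic_on_subset subset_UNIV)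
  then obtain r where r: "0 < r" "f analytic_on ball z r - {z}"
    using meromorphic_on_isolated_singularity unfolding isolated_singularity_at_def by blast
  then have holo: "f holomorphic_on ball z r - {z}" by (simp add: analytic_imp_holomorphic)
  have "open (ball z r - {z})" by (simp add: open_delete)
  then have "\<not> is_pole f x" if "x \<in> ball z r - {z}" for x
    using not_is_pole_holomorphic that holo by blast
  then show ?thesis using that r(1) holo unfolding poles_def by blast
qed

text \<open>At a pole the reciprocal extends holomorphically by 0; elsewhere \<open>f\<close> is
  holomorphic nearby and never equals \<open>b\<close>.\<close>

lemma bov_reciprocal_holomorphic:
  assumes tm: "transcendental_meromorphic f" and om: "omitted_value f b"
  shows "bov_reciprocal f b holomorphic_on A"
proof -
  have "bov_reciprocal f b field_differentiable at z" for z
  proof -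
    obtain r where r: "0 < r" "f holomorphic_on ball z r - {z}" "(ball z r - {z}) \<inter> poles f = {}"
      by (rule punctured_analytic_if_transcendental_meromorphic[OF tm])
    have ne: "f x - b \<noteq> 0" if "x \<in> ball z r - {z}" for x
      using om r(3) that unfolding omitted_value_def by force
    have "bov_reciprocal f b holomorphic_on ball z r"
    proof (cases "z \<in> poles f")
      case True
      then have "is_pole (\<lambda>x. f x - b) z"
        using is_pole_plus_const_iff[of f z "- b"] by (simp add: poles_def)
      then have "(\<lambda>x. if x = z then 0 else inverse (f x - b)) holomorphic_on ball z r"
        using r ne by (intro is_pole_inverse_holomorphic) (auto intro!: holomorphic_intros)
      then show ?thesis
        by (rule holomorphic_transform)
           (use True r(3) in \<open>force simp: bov_reciprocal_def inverse_eq_divide\<close>)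
    next
      case False
      then have "f analytic_on {z}" using tm by (simp add: transcendental_meromorphic_def)
      then obtain e where e: "0 < e" "f holomorphic_on ball z e" by (auto simp: analytic_on_def)
      have "f holomorphic_on ball z r"
      proof (rule no_isolated_singularity'[of "{z}"])
        show "(f \<longlongrightarrow> f x) (at x within ball z r)" if "x \<in> {z}" for x
        proof -
          have "isCont f z"
            using e by (meson centre_in_ball continuous_on_eq_continuous_at holomorphic_on_imp_continuous_on open_ball)
          then have "(f \<longlongrightarrow> f z) (at z)" by (simp add: isCont_def)
          then show ?thesis using that tendsto_within_subset by blast
        qed
      qed (use r in auto)
      moreover have "f x - b \<noteq> 0" if "x \<in> ball z r" for x
        using ne[of x] that om False unfolding omitted_value_def by (cases "x = z") auto
      ultimately have "(\<lambda>x. 1 / (f x - b)) holomorphic_on ball z r"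
        by (intro holomorphic_intros) auto
      then show ?thesis
        by (rule holomorphic_transform)
           (use False r(3) in \<open>auto simp: bov_reciprocal_def\<close>)
    qed
    then show ?thesis
      using r(1) by (meson centre_in_ball holomorphic_on_imp_differentiable_at open_ball)
  qed
  then show ?thesis
    by (simp add: field_differentiable_at_within holomorphic_onI)
qed

text \<open>Otherwise \<open>1 / h\<close> is bounded near infinity, and Riemann's removability
  theorem in the coordinate \<open>1 / z\<close> gives \<open>f\<close> a finite limit there, with
  no poles nearby. This contradicts the essential singularity.\<close>

lemma unbounded_sublevel_set_bov_reciprocal:
  assumes tm: "transcendental_meromorphic f" and om: "omitted_value f b" and "0 < M"
  shows "\<not> bounded {z. norm (bov_reciprocal f b z) < M}"
proof
  define h where "h = bov_reciprocal f b"
  assume "bounded {z. norm (bov_reciprocal f b z) < M}"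
  then obtain R where R: "0 < R" "\<And>z. norm (h z) < M \<Longrightarrow> norm z \<le> R"
    unfolding h_def bounded_pos by blast
  have big: "M \<le> norm (h z)" if "R < norm z" for z
    using R(2)[of z] that by linarith
  have np: "z \<notin> poles f" if "R < norm z" for z
    using big[OF that] \<open>0 < M\<close> bov_reciprocal_eq_0_iff[OF om] unfolding h_def by force
  define u where "u = (\<lambda>z. 1 / h (inverse z))"
  have inv: "R < norm (inverse z)" if "z \<in> ball 0 (1 / R) - {0}" for z :: complex
    using that R(1) by (simp add: norm_inverse field_simps norm_divide)
  have "h holomorphic_on UNIV" unfolding h_def by (rule bov_reciprocal_holomorphic[OF tm om])
  then have "(h \<circ> inverse) holomorphic_on ball 0 (1 / R) - {0}"
    by (intro holomorphic_on_compose_gen[where t = UNIV] holomorphic_intros) auto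
  moreover have "h (inverse z) \<noteq> 0" if "z \<in> ball 0 (1 / R) - {0}" for z
    using big[OF inv[OF that]] \<open>0 < M\<close> by force
  ultimately have u: "u holomorphic_on ball 0 (1 / R) - {0}"
    unfolding u_def by (intro holomorphic_intros) (auto simp: o_def)
  have "\<exists>B. eventually (\<lambda>z. norm (u z) \<le> B) (at 0)"
  proof (intro exI eventually_at_topological[THEN iffD2] conjI ballI impI)
    show "open (ball (0::complex) (1 / R))" "0 \<in> ball (0::complex) (1 / R)" using R(1) by auto
    show "norm (u z) \<le> 1 / M" if "z \<in> ball 0 (1 / R)" "z \<noteq> 0" for z
      using big[OF inv, of z] that \<open>0 < M\<close> by (simp add: u_def norm_divide frac_le)
  qed
  then obtain g where g: "g holomorphic_on ball 0 (1 / R)" "\<And>z. z \<in> ball 0 (1 / R) - {0} \<Longrightarrow> g z = u z"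
    using holomorphic_on_extend_bounded[OF u] R(1) by auto
  have "(g \<longlongrightarrow> g 0) (at 0)"
    using g(1) R(1) holomorphic_on_imp_continuous_on
    by (metis centre_in_ball continuous_on_eq_continuous_at isCont_def open_ball zero_less_divide_1_iff)
  then have "((\<lambda>z. b + g z) \<longlongrightarrow> b + g 0) (at 0)" by (intro tendsto_intros)
  then have "((f \<circ> inverse) \<longlongrightarrow> b + g 0) (at 0)"
  proof (rule Lim_transform_within_open)
    show "open (ball (0::complex) (1 / R))" "0 \<in> ball (0::complex) (1 / R)" using R(1) by auto
    show "b + g z = (f \<circ> inverse) z" if "z \<in> ball 0 (1 / R)" "z \<noteq> 0" for z
      using g(2)[of z] that eq_bov_reciprocal[OF om np[OF inv, of z]] by (simp add: u_def h_def)
  qed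
  then have "(f \<longlongrightarrow> b + g 0) at_infinity" by (simp add: lim_at_infinity_0)
  then show False using tm np unfolding transcendental_meromorphic_def by blast
qed

text \<open>Poles are isolated, so a constant value \<open>c\<close> would be nonzero; the sublevel
  set at level \<open>norm c\<close> would then be empty, hence bounded.\<close>

lemma bov_reciprocal_not_constant:
  assumes tm: "transcendental_meromorphic f" and om: "omitted_value f b"
  shows "\<not> bov_reciprocal f b constant_on UNIV"
proof
  assume "bov_reciprocal f b constant_on UNIV"
  then obtain c where c: "\<And>z. bov_reciprocal f b z = c" by (auto simp: constant_on_def)
  obtain r where r: "0 < r" "(ball 0 r - {0}) \<inter> poles f = {}"
    using punctured_analytic_if_transcendental_meromorphic[OF tm] by metis
  moreover have "of_real (r / 2) \<in> ball 0 r - {0 :: complex}" using r(1) by (simp del: of_real_divide)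
  ultimately have "of_real (r / 2) \<notin> poles f" by blast
  then have "c \<noteq> 0" using c bov_reciprocal_eq_0_iff[OF om] by blast
  then show False
    using unbounded_sublevel_set_bov_reciprocal[OF tm om, of "norm c"] c by simp
qed

lemma superlevel_set_bov_reciprocal:
  assumes "omitted_value f b" "0 < r"
  shows "{z. z \<notin> poles f \<and> f z \<in> ball b r} = {z. 1 / r < norm (bov_reciprocal f b z)}"
proof -
  have "f z \<in> ball b r \<longleftrightarrow> 1 / r < norm (bov_reciprocal f b z)" if "z \<notin> poles f" for z
  proof -
    have "0 < norm (f z - b)" using assms(1) that by (simp add: omitted_value_def)
    then show ?thesis
      using that assms(2)
      by (simp add: bov_reciprocal_def norm_divide dist_norm norm_minus_commute field_simps)
  qed
  moreover have "\<not> 1 / r < norm (bov_reciprocal f b z)" if "z \<in> poles f" for z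
    using that assms(2) by (simp add: bov_reciprocal_def)
  ultimately show ?thesis by blast
qed

lemma deriv_eq_bov_reciprocal:
  assumes tm: "transcendental_meromorphic f" and om: "omitted_value f b" and z: "z \<notin> poles f"
  defines "h \<equiv> bov_reciprocal f b"
  shows "deriv f z = - deriv h z / (h z)\<^sup>2"
proof -
  have h: "h holomorphic_on UNIV" unfolding h_def by (rule bov_reciprocal_holomorphic[OF tm om])
  have hz: "h z \<noteq> 0" using z bov_reciprocal_eq_0_iff[OF om] by (simp add: h_def)
  have "((\<lambda>z. b + 1 / h z) has_field_derivative - deriv h z / (h z)\<^sup>2) (at z)"
    using holomorphic_derivI[OF h open_UNIV UNIV_I, of z] hz
    by (auto intro!: derivative_eq_intros simp: power2_eq_square)
  moreover have "open {z. h z \<noteq> 0}"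
    by (intro open_Collect_neq holomorphic_on_imp_continuous_on[OF h] continuous_intros)
  ultimately have "(f has_field_derivative - deriv h z / (h z)\<^sup>2) (at z)"
    by (rule has_field_derivative_transform_within_open)
       (use hz eq_bov_reciprocal[OF om] bov_reciprocal_eq_0_iff[OF om] in \<open>auto simp: h_def\<close>)
  then show ?thesis by (rule DERIV_imp_deriv)
qed

subsection \<open>Fixed points in a far component\<close>

text \<open>The Moebius map taking \<open>\<mu>\<close> to \<open>1 / (1 - \<mu>)\<close> sends the
  unit circle to the line \<open>Re = 1 / 2\<close>. The two hypotheses hold for the multiplier of a
  fixed point that is not weakly repelling.\<close>

lemma Re_inverse_one_minus_ge_half:
  fixes \<mu> :: complex
  assumes "norm \<mu> \<le> 1" "\<mu> \<noteq> 1"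
  shows "1 / 2 \<le> Re (1 / (1 - \<mu>))"
proof -
  have "(Re \<mu>)\<^sup>2 + (Im \<mu>)\<^sup>2 \<le> 1"
    using assms(1) by (metis cmod_power2 norm_ge_zero one_power2 power_mono)
  moreover have "0 < (Re (1 - \<mu>))\<^sup>2 + (Im (1 - \<mu>))\<^sup>2"
    using assms(2) by (metis complex_neq_0 right_minus_eq)
  ultimately have "(Re (1 - \<mu>))\<^sup>2 + (Im (1 - \<mu>))\<^sup>2 \<le> 2 * Re (1 - \<mu>)"
    by (simp add: power2_eq_square algebra_simps)
  with \<open>0 < _\<close> show ?thesis by (simp add: Re_divide field_simps)
qed

text \<open>The condition \<open>8 / M \<le> R\<close> makes \<open>w\<close> at most
  \<open>M / 8\<close> on \<open>\<Omega>\<close>, a small perturbation of \<open>h\<close>;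
  \<open>0 < R\<close> keeps \<open>b\<close> outside \<open>\<Omega>\<close>, so that
  \<open>w\<close> is holomorphic there.\<close>

locale far_component =
  fixes f :: "complex \<Rightarrow> complex" and b :: complex and M R :: real and \<Omega> :: "complex set"
  assumes tm: "transcendental_meromorphic f" and om: "omitted_value f b"
    and R: "0 < R" "8 / M \<le> R" and M: "0 < M"
    and \<Omega>: "\<Omega> \<in> components {z. norm (bov_reciprocal f b z) < M}" "bounded \<Omega>"
      "\<Omega> \<inter> cball b R = {}"
begin

definition h where "h = bov_reciprocal f b"
definition w where "w z = 1 / (z - b)"

lemma h_holo: "h holomorphic_on A"
  unfolding h_def by (rule bov_reciprocal_holomorphic[OF tm om])

lemma in_comp: "\<Omega> \<in> components {z. norm (h z) < M}"
  using \<Omega>(1) by (simp add: h_def)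

lemmas open_\<Omega> = simply_connected_component_sublevel_set(1)[OF h_holo in_comp]
lemmas sc_\<Omega> = simply_connected_component_sublevel_set(2)[OF h_holo in_comp]
lemmas compact_sub = compact_component_sublevel_set[OF h_holo in_comp \<Omega>(2)]

lemma far: "z \<in> \<Omega> \<Longrightarrow> R < norm (z - b)"
  using \<Omega>(3) by (auto simp: dist_norm norm_minus_commute disjoint_iff not_le)

lemma ne_b: "z \<in> \<Omega> \<Longrightarrow> z \<noteq> b"
  using far R by fastforce

lemma norm_w_le:
  assumes z: "z \<in> \<Omega>"
  shows "norm (w z) \<le> M / 8"
proof -
  have "8 / M \<le> norm (z - b)" using far[OF z] R by simp
  then show ?thesis using M ne_b[OF z] by (simp add: w_def norm_divide field_simps)
qed

lemma w_deriv: "z \<noteq> b \<Longrightarrow> (w has_field_derivative - ((w z)\<^sup>2)) (at z)"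
  unfolding w_def[abs_def] by (auto intro!: derivative_eq_intros simp: power2_eq_square field_simps)

lemma w_holo: "w holomorphic_on \<Omega>"
  using ne_b unfolding w_def[abs_def] by (intro holomorphic_intros) auto

lemma w_inj: "inj_on w \<Omega>"
  using ne_b by (auto simp: inj_on_def w_def)

text \<open>At a pole \<open>h\<close> vanishes but \<open>w\<close> does not, so poles produce no
  spurious zeros; elsewhere the equation is the reciprocal of
  \<open>f z - b = z - b\<close>.\<close>

lemma fixed_point_iff:
  assumes "z \<in> \<Omega>"
  shows "z \<in> fixed_points f \<longleftrightarrow> w z - h z = 0"
proof (cases "z \<in> poles f")
  case True
  then have "h z = 0" using bov_reciprocal_eq_0_iff[OF om] by (simp add: h_def)
  then show ?thesis using True ne_b[OF assms] by (simp add: fixed_points_def w_def)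
next
  case False
  then have "f z - b \<noteq> 0" using om by (simp add: omitted_value_def)
  then have "w z - h z = 0 \<longleftrightarrow> f z - b = z - b"
    using False ne_b[OF assms] by (auto simp: h_def bov_reciprocal_def w_def)
  then show ?thesis using False by (simp add: fixed_points_def)
qed

text \<open>At a fixed point \<open>h = w\<close>, so in \<open>f' = - h' / h^2\<close> the square
  can be replaced by \<open>w^2 = - w'\<close>. That \<open>w\<close> is nonzero also shows that the
  point is no pole.\<close>

lemma deriv_fixed_point:
  assumes "z \<in> \<Omega>" "w z - h z = 0"
  shows "w z \<noteq> 0" "deriv f z = deriv h z / deriv w z"
    "deriv (\<lambda>z. w z - h z) z = deriv w z - deriv h z" "deriv w z \<noteq> 0"
proof -
  show wz: "w z \<noteq> 0" using ne_b[OF assms(1)] by (simp add: w_def)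
  have dw: "deriv w z = - ((w z)\<^sup>2)" using w_deriv ne_b[OF assms(1)] by (simp add: DERIV_imp_deriv)
  then show "deriv w z \<noteq> 0" using wz by simp
  have "z \<notin> poles f" using wz assms(2) bov_reciprocal_eq_0_iff[OF om] unfolding h_def by force
  then show "deriv f z = deriv h z / deriv w z"
    using deriv_eq_bov_reciprocal[OF tm om] assms(2) dw unfolding h_def by simp
  show "deriv (\<lambda>z. w z - h z) z = deriv w z - deriv h z"
    using w_deriv[OF ne_b[OF assms(1)]] h_holo[of UNIV]
    by (intro deriv_diff) (auto simp: field_differentiable_def intro: holomorphic_derivI)
qed

text \<open>On this set \<open>norm h\<close> is at most \<open>\<tau> + M / 8 < M\<close>, since
  \<open>w\<close> is at most \<open>M / 8\<close>; so the set is closed in a compact sublevel set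
  of \<open>h\<close>. This explains the factor 7/8.\<close>

lemma compact_sublevel_diff:
  assumes "\<tau> < 7 / 8 * M"
  shows "compact {z \<in> \<Omega>. norm (w z - h z) \<le> \<tau>}"
proof -
  define K where "K = {z \<in> \<Omega>. norm (h z) \<le> \<tau> + M / 8}"
  have K: "compact K" unfolding K_def using assms by (intro compact_sub) simp
  have "continuous_on K (\<lambda>z. w z - h z)"
    using w_holo h_holo by (intro continuous_intros holomorphic_on_imp_continuous_on)
      (auto simp: K_def elim: holomorphic_on_subset)
  then have "closed (K \<inter> (\<lambda>z. w z - h z) -` cball 0 \<tau>)"
    using K by (intro continuous_closed_preimage compact_imp_closed) auto
  then have "compact (K \<inter> (K \<inter> (\<lambda>z. w z - h z) -` cball 0 \<tau>))"
    using K by (intro compact_Int_closed)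
  moreover have "norm (h z) \<le> \<tau> + M / 8" if "z \<in> \<Omega>" "norm (w z - h z) \<le> \<tau>" for z
    using norm_w_le[OF that(1)] that(2) norm_triangle_ineq4[of "w z" "w z - h z"] by simp
  then have "K \<inter> (K \<inter> (\<lambda>z. w z - h z) -` cball 0 \<tau>) = {z \<in> \<Omega>. norm (w z - h z) \<le> \<tau>}"
    unfolding K_def by auto
  ultimately show ?thesis by simp
qed

lemma diff_holo: "(\<lambda>z. w z - h z) holomorphic_on \<Omega>"
  by (intro holomorphic_intros w_holo h_holo)

text \<open>Properness gives \<open>h\<close> a zero in \<open>\<Omega>\<close>. There
  \<open>w - h\<close> has modulus at most \<open>M / 8\<close>, so this map, proper over the disk
  of radius \<open>7 / 8 * M\<close>, takes one value in that disk and hence all of them, including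
  0.\<close>

lemma ex_fixed_point: "\<exists>z\<in>\<Omega>. w z - h z = 0"
proof -
  note conn = simply_connected_imp_connected[OF sc_\<Omega>]
  obtain z0 where "z0 \<in> \<Omega>" using in_components_nonempty[OF in_comp] by blast
  moreover have "norm (h z0) < M" using in_components_subset[OF in_comp] calculation by blast
  ultimately have "ball 0 M \<subseteq> h ` \<Omega>"
    by (intro ball_subset_image_if_proper[OF open_\<Omega> conn h_holo compact_sub])
  moreover have "0 \<in> ball (0::complex) M" using M by simp
  ultimately obtain z1 where z1: "z1 \<in> \<Omega>" "h z1 = 0" by (metis imageE subsetD)
  then have "norm (w z1 - h z1) < 7 / 8 * M" using norm_w_le[of z1] M by simp
  then have "ball 0 (7 / 8 * M) \<subseteq> (\<lambda>z. w z - h z) ` \<Omega>"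
    using z1(1)
    by (intro ball_subset_image_if_proper[OF open_\<Omega> conn diff_holo compact_sublevel_diff])
  moreover have "0 \<in> ball (0::complex) (7 / 8 * M)" using M by simp
  ultimately show ?thesis by (metis (no_types, lifting) imageE subsetD)
qed

lemma ex_weakly_repelling: "\<exists>z\<in>\<Omega>. weakly_repelling_fp f z"
proof (rule ccontr)
  assume "\<not> ?thesis"
  then have *: "norm (deriv f z) \<le> 1" "deriv f z \<noteq> 1" if "z \<in> \<Omega>" "w z - h z = 0" for z
    using that fixed_point_iff unfolding weakly_repelling_fp_def by (meson not_less)+
  define Z where "Z = {z \<in> \<Omega>. w z - h z = 0}"
  define k where "k = (\<lambda>z. w z - h z)"
  \<comment> \<open>At a zero \<open>k' = w' (1 - \<lambda>)\<close> with
    \<open>\<lambda> = deriv f z\<close>, so \<open>\<lambda> \<noteq> 1\<close> says exactly that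
    the zero is simple.\<close>
  have quot: "deriv w z / deriv k z = 1 / (1 - deriv f z)" "deriv k z \<noteq> 0" if "z \<in> Z" for z
  proof -
    have z: "z \<in> \<Omega>" "w z - h z = 0" using that by (auto simp: Z_def)
    note d = deriv_fixed_point[OF z]
    have "deriv w z - deriv h z = deriv w z * (1 - deriv f z)"
      using d(2,4) by (simp add: field_simps)
    then show "deriv w z / deriv k z = 1 / (1 - deriv f z)" "deriv k z \<noteq> 0"
      using d(3,4) *(2)[OF z] by (simp_all add: k_def)
  qed
  have "compact {z \<in> \<Omega>. norm (k z) \<le> 3 / 4 * M}"
    unfolding k_def using M by (intro compact_sublevel_diff) simp
  moreover have "\<Omega> \<noteq> {}" using in_components_nonempty[OF in_comp] .
  moreover have Zk: "Z = {z \<in> \<Omega>. k z = 0}" by (simp add: Z_def k_def)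
  \<comment> \<open>The level \<open>3 / 4 * M\<close> lies below the properness bound
    \<open>7 / 8 * M\<close> and above the Cauchy radius \<open>M / 2\<close>. The resulting bound
    is \<open>card Z / 4\<close>, half of the lower bound \<open>card Z / 2\<close> derived
    next.\<close>
  ultimately have "finite Z"
    and le: "norm (\<Sum>z\<in>Z. deriv w z / deriv k z) \<le> M / 8 * card Z / (M / 2)"
    using norm_sum_deriv_quotient_zeros_le_simply_connected[OF open_\<Omega> sc_\<Omega> \<Omega>(2) _
        diff_holo[folded k_def] w_holo _ norm_w_le, of "3 / 4 * M" "M / 2"] quot(2) M
    by auto
  have "card Z / 2 = (\<Sum>z\<in>Z. 1 / 2 :: real)" by simp
  also have "\<dots> \<le> (\<Sum>z\<in>Z. Re (deriv w z / deriv k z))"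
    using quot(1) * Re_inverse_one_minus_ge_half by (intro sum_mono) (simp add: Z_def)
  also have "\<dots> \<le> norm (\<Sum>z\<in>Z. deriv w z / deriv k z)"
    unfolding Re_sum[symmetric] by (rule complex_Re_le_cmod)
  also have "\<dots> \<le> card Z / 4" using le M by (simp add: field_simps)
  finally have "card Z = 0" by simp
  then have "Z = {}" using \<open>finite Z\<close> by simp
  then show False using ex_fixed_point by (auto simp: Z_def)
qed

lemma ex_repelling:
  assumes "critical_values f \<subseteq> cball b R"
  shows "\<exists>z\<in>\<Omega>. repelling_fp f z"
proof -
  obtain z where z: "z \<in> \<Omega>" "w z - h z = 0" using ex_fixed_point by blast
  note d = deriv_fixed_point[OF z]
  have "norm (deriv w z) < norm (deriv h z)"
  proof (rule norm_deriv_less_at_coincidence[OF open_\<Omega> sc_\<Omega> \<Omega>(2) h_holo w_holo w_inj norm_w_le _ compact_sub])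
    show "M / 8 < M" using M by simp
    show "z \<in> \<Omega>" "h z = w z" using z by auto
    \<comment> \<open>If \<open>h x = w y\<close> with \<open>y\<close> in \<open>\<Omega>\<close>,
      then \<open>f x = y\<close>; a critical point \<open>x\<close> would make \<open>y\<close> a
      critical value of \<open>f\<close> outside the disk.\<close>
    show "deriv h x \<noteq> 0" if x: "x \<in> \<Omega>" "h x \<in> w ` \<Omega>" for x
    proof
      assume dx: "deriv h x = 0"
      obtain y where y: "y \<in> \<Omega>" "h x = w y" using x(2) by blast
      then have "h x \<noteq> 0" using ne_b by (simp add: w_def)
      then have np: "x \<notin> poles f" using bov_reciprocal_eq_0_iff[OF om] by (simp add: h_def)
      have "f x = y" using eq_bov_reciprocal[OF om np] y(2) by (simp add: w_def flip: h_def)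
      moreover have "deriv f x = 0"
        using deriv_eq_bov_reciprocal[OF tm om np] dx by (simp add: h_def)
      ultimately have "y \<in> critical_values f" using np unfolding critical_values_def by blast
      then show False using assms y(1) \<Omega>(3) by blast
    qed
  qed
  then have "1 < norm (deriv f z)" using d(2,4) by (simp add: norm_divide)
  then show ?thesis using z fixed_point_iff unfolding repelling_fp_def by blast
qed

end

section \<open>Arbitrarily distant components and infinitely many fixed points\<close>

lemma ex_far_component:
  assumes "transcendental_meromorphic f" "baker_omitted_value f b"
  obtains M where "0 < M" "\<And>R. \<lbrakk>0 < R; 8 / M \<le> R\<rbrakk> \<Longrightarrow> \<exists>\<Omega>. far_component f b M R \<Omega>"
proof -
  have om: "omitted_value f b" using assms(2) by (simp add: baker_omitted_value_def)
  obtain r where r: "0 < r"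
    "\<forall>C\<in>components (frontier {z. z \<notin> poles f \<and> f z \<in> ball b r}). bounded C"
    using assms(2) by (auto simp: baker_omitted_value_def)
  note h = bov_reciprocal_holomorphic[OF assms(1) om, of UNIV]
    bov_reciprocal_not_constant[OF assms(1) om]
  \<comment> \<open>The condition \<open>norm (f z - b) < r\<close> corresponds to
    \<open>norm h > 1 / r\<close>, so the boundary of the preimage of the disk is the level set of
    \<open>norm h\<close> at \<open>M\<close>.\<close>
  define M where "M = 1 / r"
  have M: "0 < M" using r(1) by (simp add: M_def)
  have bd: "bounded C" if "C \<in> components {z. norm (bov_reciprocal f b z) = M}" for C
    using r(2) that
    unfolding superlevel_set_bov_reciprocal[OF om r(1)] frontier_superlevel_set[OF h] M_def by blast
  have "\<exists>\<Omega>. far_component f b M R \<Omega>" if R: "0 < R" "8 / M \<le> R" for R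
  proof -
    obtain \<Omega> where "\<Omega> \<in> components {z. norm (bov_reciprocal f b z) < M}" "bounded \<Omega>"
      "\<Omega> \<inter> cball b R = {}"
      by (rule far_component_sublevel_set[where b = b and R = R, OF h])
         (use bd unbounded_sublevel_set_bov_reciprocal[OF assms(1) om M] R(1) in auto)
    then show ?thesis
      using assms(1) om R M by (auto simp: far_component_def)
  qed
  then show ?thesis using that M by blast
qed

lemma infinite_if_arbitrarily_far:
  fixes A :: "complex set"
  assumes "\<And>R. R0 \<le> R \<Longrightarrow> \<exists>z\<in>A. z \<notin> cball b R"
  shows "infinite A"
proof
  assume "finite A"
  then obtain e where "\<forall>y\<in>A. dist b y \<le> e"
    using finite_imp_bounded bounded_any_center by blast
  then have "A \<subseteq> cball b (max e R0)" by auto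
  then show False using assms[of "max e R0"] by force
qed

theorem theorem1p3:
  fixes f :: "complex \<Rightarrow> complex"
  assumes "class_MS f"
  shows "infinite {z. weakly_repelling_fp f z} \<and>
         (\<forall>b. stable_bov f b \<and> {x. x islimpt critical_values f} = {b} \<and>
              bounded (critical_values f) \<longrightarrow> infinite {z. repelling_fp f z})"
proof (intro conjI allI impI)
  have tm: "transcendental_meromorphic f"
    using assms by (simp add: class_MS_def general_transcendental_meromorphic_def)
  show "infinite {z. weakly_repelling_fp f z}"
  proof -
    obtain b where "baker_omitted_value f b"
      using assms by (auto simp: class_MS_def stable_bov_def)
    then obtain M where M: "0 < M" "\<And>R. \<lbrakk>0 < R; 8 / M \<le> R\<rbrakk> \<Longrightarrow> \<exists>\<Omega>. far_component f b M R \<Omega>"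
      using ex_far_component[OF tm] by metis
    show ?thesis
    proof (rule infinite_if_arbitrarily_far[of "max 1 (8 / M)" _ b])
      fix R assume "max 1 (8 / M) \<le> R"
      then obtain \<Omega> where \<Omega>: "far_component f b M R \<Omega>" using M(2)[of R] by auto
      then show "\<exists>z\<in>{z. weakly_repelling_fp f z}. z \<notin> cball b R"
        using far_component.ex_weakly_repelling[OF \<Omega>] far_component.\<Omega>(3)[OF \<Omega>] by blast
    qed
  qed
  fix b assume b: "stable_bov f b \<and> {x. x islimpt critical_values f} = {b} \<and> bounded (critical_values f)"
  then obtain M where M: "0 < M" "\<And>R. \<lbrakk>0 < R; 8 / M \<le> R\<rbrakk> \<Longrightarrow> \<exists>\<Omega>. far_component f b M R \<Omega>"
    using ex_far_component[OF tm] unfolding stable_bov_def by metis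
  obtain e where e: "\<forall>y\<in>critical_values f. dist b y \<le> e"
    using b bounded_any_center by blast
  show "infinite {z. repelling_fp f z}"
  \<comment> \<open>Including \<open>e\<close> in the lower bound for \<open>R\<close> puts all
    critical values inside \<open>cball b R\<close>; the other entries give \<open>0 < R\<close> and
    \<open>8 / M \<le> R\<close>.\<close>
  proof (rule infinite_if_arbitrarily_far[of "max e (max 1 (8 / M))" _ b])
    fix R assume R: "max e (max 1 (8 / M)) \<le> R"
    then obtain \<Omega> where \<Omega>: "far_component f b M R \<Omega>" using M(2)[of R] by auto
    have "critical_values f \<subseteq> cball b R" using e R by force
    then show "\<exists>z\<in>{z. repelling_fp f z}. z \<notin> cball b R"
      using far_component.ex_repelling[OF \<Omega>] far_component.\<Omega>(3)[OF \<Omega>] by blast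
  qed
qed

end
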